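(* Let $f_1,\dots,f_k$ be tropical polynomials in $n$ variables and let $V=V(f_1,\dots,f_k)\subset\mathbb{R}^n$ be the tropical prevariety they define. Let $P_i\subset\mathbb{R}^n$ be the Newton polytope of $f_i$, let $r$ be the dimension of the Minkowski sum $P_1+\cdots+P_k$, and assume that its $r$-dimensional volume $\mathrm{Vol}_r(P_1+\cdots+P_k)$ is positive. Then the number of faces of all dimensions of $V$ does not exceed $$(2^{r+1}-1)\, r!\ \mathrm{Vol}_r(P_1+\cdots+P_k).$$
   Context: A tropical polynomial $f$ in $n$ variables is a function $f(x)=\min\{L_1(x),\dots,L_m(x)\}$ on $\mathbb{R}^n$, where each tropical monomial $L_j(x)=\sum_{i=1}^n a_{ji}x_i+b_j$ has non-negative integer coefficients $a_{ji}$ and real constant term $b_j$. The tropical hypersurface $V(f)$ is the set of points of $\mathbb{R}^n$ where this piecewise-linear function is not smooth (equivalently, where the minimum is attained by at least two distinct monomials). A tropical prevariety $V(f_1,\dots,f_k)$ is the intersection $V(f_1)\cap\cdots\cap V(f_k)$. The Newton polytope of $f$ is the convex hull of the exponent vectors $(a_{j1},\dots,a_{jn})$, $1\le j\le m$. The prevariety $V$ carries a natural structure of a finite polyhedral complex: for $x\in\mathbb{R}^n$ let $S_i(x)$ be the set of monomials of $f_i$ attaining the minimum at $x$; the faces (cells) of $V$ are the closures of the nonempty sets of the form $\{x: S_i(x)=S_i \text{ for all } i\}$ contained in $V$. *)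

theory Defs
  imports "HOL-Analysis.Analysis" "HOL-Probability.Probability"
begin

text \<open>A tropical monomial in the variables indexed by the finite type 'n:
  an exponent vector of non-negative integers and a real constant term.\<close>
type_synonym 'n trop_monomial = "('n \<Rightarrow> nat) \<times> real"

type_synonym 'n trop_poly = "'n trop_monomial set"

definition is_trop_poly :: "'n trop_poly \<Rightarrow> bool" where
  "is_trop_poly f \<longleftrightarrow> finite f \<and> f \<noteq> {}"

definition mono_eval :: "('n::finite) trop_monomial \<Rightarrow> real^'n \<Rightarrow> real" where
  "mono_eval m x = (\<Sum>i\<in>UNIV. real (fst m i) * x $ i) + snd m"

definition trop_eval :: "('n::finite) trop_poly \<Rightarrow> real^'n \<Rightarrow> real" where
  "trop_eval f x = Min ((\<lambda>m. mono_eval m x) ` f)"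

definition attaining :: "('n::finite) trop_poly \<Rightarrow> real^'n \<Rightarrow> 'n trop_monomial set" where
  "attaining f x = {m \<in> f. \<forall>m'\<in>f. mono_eval m x \<le> mono_eval m' x}"

definition trop_hypersurface :: "('n::finite) trop_poly \<Rightarrow> (real^'n) set" where
  "trop_hypersurface f = {x. 2 \<le> card (attaining f x)}"

definition trop_prevariety :: "('n::finite) trop_poly list \<Rightarrow> (real^'n) set" where
  "trop_prevariety fs = {x. \<forall>i<length fs. x \<in> trop_hypersurface (fs ! i)}"

definition prevariety_faces :: "('n::finite) trop_poly list \<Rightarrow> (real^'n) set set" where
  "prevariety_faces fs =
     {closure C | C. \<exists>\<sigma> :: nat \<Rightarrow> 'n trop_monomial set.
        C = {x. \<forall>i<length fs. attaining (fs ! i) x = \<sigma> i}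
        \<and> C \<noteq> {} \<and> C \<subseteq> trop_prevariety fs}"

definition newton_polytope :: "('n::finite) trop_poly \<Rightarrow> (real^'n) set" where
  "newton_polytope f = convex hull ((\<lambda>m. \<chi> i. real (fst m i)) ` f)"

definition minkowski_sum :: "('a::real_vector) set list \<Rightarrow> 'a set" where
  "minkowski_sum Ps = foldr (\<lambda>A B. {a + b | a b. a \<in> A \<and> b \<in> B}) Ps {0}"

text \<open>r-dimensional volume of a set S (meant for S with aff_dim S = r):
  choose an orthonormal affine parametrisation t \<mapsto> a + sum_{j<r} t_j u_j of the
  affine hull of S and take the r-dimensional Lebesgue measure (product of r copies
  of lborel) of the parameter set of S. For r = 0 this is counting measure.\<close>
definition vol_param :: "nat \<Rightarrow> ('a::euclidean_space) \<Rightarrow> (nat \<Rightarrow> 'a) \<Rightarrow> (nat \<Rightarrow> real) \<Rightarrow> 'a" where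
  "vol_param r a u t = a + (\<Sum>j<r. t j *\<^sub>R u j)"

definition vol_r :: "nat \<Rightarrow> ('a::euclidean_space) set \<Rightarrow> real" where
  "vol_r r S =
     (let (a, u) = (SOME (a, u). (\<forall>i<r. \<forall>j<r. inner (u i) (u j) = (if i = j then 1 else 0))
                     \<and> affine hull S = vol_param r a u ` (PiE {..<r} (\<lambda>_. UNIV)))
      in measure (PiM {..<r} (\<lambda>_. lborel))
           {t \<in> PiE {..<r} (\<lambda>_. UNIV). vol_param r a u t \<in> S})"

end

theory Submission
  imports Defs "HOL-Computational_Algebra.Polynomial"
begin

text \<open>
  Multiplying the polynomials tropically reduces the count to one piecewise-linear function: its
  monomials are the sums of one monomial from each factor, its Newton polytope is the Minkowski sum
  \<open>P\<close>, and the set of monomials attaining the minimum at a point determines all the sets \<open>S\<^sub>i\<close> there.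
  Dually, these sets are the cells of the regular subdivision of \<open>P\<close> induced by the constant terms.

  A generic small perturbation of the constant terms refines this subdivision to a triangulation of
  \<open>P\<close> with vertices in the integer lattice. Sending a cell to the smallest face of the triangulation
  containing its barycentre is injective, and an \<open>r\<close>-simplex has \<open>2\<^bsup>r+1\<^esup> - 1\<close> nonempty faces. Finally an
  \<open>r\<close>-dimensional lattice simplex has volume at least \<open>1 / r!\<close>, because the square of \<open>r!\<close> times its
  volume is the Gram determinant of integer vectors; so there are at most \<open>r! Vol\<^sub>r(P)\<close> simplices.

  The triangulation is obtained by linear programming over the homogenised exponents \<open>w g = (v, 1)\<close>:
  an affine function below all heights \<open>b\<close> is a vector \<open>y\<close> with \<open>y \<bullet> w g \<le> b g\<close>, and cells are the sets
  of tight constraints.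
\<close>

section \<open>Regular triangulations\<close>

definition feasible :: "'i set \<Rightarrow> ('i \<Rightarrow> 'e::euclidean_space) \<Rightarrow> ('i \<Rightarrow> real) \<Rightarrow> 'e \<Rightarrow> bool" where
  "feasible G w b y \<longleftrightarrow> (\<forall>g\<in>G. y \<bullet> w g \<le> b g)"

definition tight_set :: "'i set \<Rightarrow> ('i \<Rightarrow> 'e::euclidean_space) \<Rightarrow> ('i \<Rightarrow> real) \<Rightarrow> 'e \<Rightarrow> 'i set" where
  "tight_set G w b y = {g\<in>G. y \<bullet> w g = b g}"

text \<open>Bases of the full span, the candidates for maximal simplices. They are recorded as sets
  of indices because distinct indices may carry the same vector: two lifted monomials can share an
  exponent and differ in height.\<close>

definition basis_family :: "'i set \<Rightarrow> ('i \<Rightarrow> 'e::euclidean_space) \<Rightarrow> 'i set \<Rightarrow> bool" where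
  "basis_family G w \<tau> \<longleftrightarrow>
     \<tau> \<subseteq> G \<and> inj_on w \<tau> \<and> independent (w ` \<tau>) \<and> span (w ` \<tau>) = span (w ` G)"

text \<open>The functional interpolating \<open>b\<close> on a basis misses the height of every
  further index. A tight set of full span is then itself a basis, so the induced subdivision is
  simplicial.\<close>

definition generic :: "'i set \<Rightarrow> ('i \<Rightarrow> 'e::euclidean_space) \<Rightarrow> ('i \<Rightarrow> real) \<Rightarrow> bool" where
  "generic G w b \<longleftrightarrow> (\<forall>\<tau> h c. basis_family G w \<tau> \<longrightarrow> h \<in> G - \<tau> \<longrightarrow>
     w h = (\<Sum>g\<in>\<tau>. c g *\<^sub>R w g) \<longrightarrow> b h \<noteq> (\<Sum>g\<in>\<tau>. c g * b g))"

section \<open>Vertices of the feasible region\<close>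

text \<open>Moving orthogonally to the tight vectors keeps them tight. The first new constraint to
  become tight has nonzero product with the direction, so it lies outside the old span. As
  \<open>p\<close> is in the cone of the vectors, some such direction is blocked and does not lower
  the objective.\<close>

lemma feasible_raise_dim_tight:
  fixes w :: "'i \<Rightarrow> 'e::euclidean_space"
  assumes G: "finite G" and y: "feasible G w b y"
    and p: "p = (\<Sum>g\<in>G. c g *\<^sub>R w g)" and c: "\<And>g. g \<in> G \<Longrightarrow> 0 \<le> c g"
    and ns: "span (w ` tight_set G w b y) \<noteq> span (w ` G)"
  shows "\<exists>y'. feasible G w b y' \<and> y \<bullet> p \<le> y' \<bullet> p \<and>
    dim (w ` tight_set G w b y) < dim (w ` tight_set G w b y')"
proof -
  let ?Z = "tight_set G w b y"
  have "span (w ` ?Z) \<subset> span (w ` G)"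
    using ns span_mono[of "w ` ?Z" "w ` G"] by (auto simp: tight_set_def)
  then obtain z0 where z0: "z0 \<noteq> 0" "z0 \<in> span (w ` G)" "\<And>x. x \<in> span (w ` ?Z) \<Longrightarrow> orthogonal z0 x"
    using orthogonal_to_subspace_exists_gen by blast
  have "\<exists>g\<in>G. z0 \<bullet> w g \<noteq> 0"
  proof (rule ccontr)
    assume "\<not> ?thesis"
    then have "orthogonal z0 z0"
      by (intro orthogonal_to_span[OF z0(2)]) (auto simp: orthogonal_def)
    then show False using z0(1) by (simp add: orthogonal_def)
  qed
  then obtain g1 where g1: "g1 \<in> G" "z0 \<bullet> w g1 \<noteq> 0" by auto
  have pz: "z \<bullet> p = (\<Sum>g\<in>G. c g * (z \<bullet> w g))" for z
    by (simp add: p inner_sum_right)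
  \<comment> \<open>\<open>z0\<close> or \<open>- z0\<close> does not lower the objective. If the
    chosen one has no positive product with any \<open>w g\<close>, the objective is constant along
    it because \<open>p\<close> lies in the cone, and the opposite direction serves.\<close>
  obtain z where z: "\<And>x. x \<in> span (w ` ?Z) \<Longrightarrow> z \<bullet> x = 0" "z \<bullet> p \<ge> 0" "\<exists>g\<in>G. z \<bullet> w g > 0"
  proof -
    note goal = that
    have orth: "z0 \<bullet> x = 0" "(- z0) \<bullet> x = 0" if "x \<in> span (w ` ?Z)" for x
      using z0(3)[OF that] by (auto simp: orthogonal_def)
    have *: thesis if o: "\<And>x. x \<in> span (w ` ?Z) \<Longrightarrow> z1 \<bullet> x = 0" and pos: "z1 \<bullet> p \<ge> 0"
      and nz: "z1 \<bullet> w g1 \<noteq> 0" for z1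
    proof (cases "\<exists>g\<in>G. z1 \<bullet> w g > 0")
      case True
      then show thesis using goal[of z1] o pos by blast
    next
      case False
      have "z1 \<bullet> p \<le> 0"
        unfolding pz using False c by (intro sum_nonpos) (auto intro!: mult_nonneg_nonpos simp: not_less)
      then have "(- z1) \<bullet> p \<ge> 0" by simp
      moreover have "(- z1) \<bullet> w g1 > 0" using False nz g1 by (force simp: not_less)
      ultimately show thesis using goal[of "- z1"] o g1 by force
    qed
    show thesis
    proof (cases "z0 \<bullet> p \<ge> 0")
      case True then show ?thesis using *[of z0] orth g1 by blast
    next
      case False then show ?thesis using *[of "- z0"] orth g1 by simp
    qed
  qed
  \<comment> \<open>Ratio test of the simplex method: only indices in \<open>S\<close> can block the
    motion, and \<open>r g\<close> is the step length at which \<open>g\<close> becomes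
    tight.\<close>
  define S where "S = {g\<in>G. z \<bullet> w g > 0}"
  define r where "r g = (b g - y \<bullet> w g) / (z \<bullet> w g)" for g
  have S: "finite S" "S \<noteq> {}" using G z(3) by (auto simp: S_def)
  then obtain g0 where g0: "g0 \<in> S" "\<And>g. g \<in> S \<Longrightarrow> r g0 \<le> r g"
    using ex_is_arg_min_if_finite[OF S, of r] by (auto simp: is_arg_min_linorder)
  have r0: "r g0 \<ge> 0" using g0(1) y by (auto simp: r_def S_def feasible_def)
  define y' where "y' = y + r g0 *\<^sub>R z"
  have ev: "y' \<bullet> x = y \<bullet> x + r g0 * (z \<bullet> x)" for x by (simp add: y'_def inner_add_left)
  have feas: "feasible G w b y'"
    unfolding feasible_def
  proof
    fix g assume g: "g \<in> G"
    show "y' \<bullet> w g \<le> b g"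
    proof (cases "g \<in> S")
      case True
      then have "r g0 * (z \<bullet> w g) \<le> b g - y \<bullet> w g"
        using g0(2)[OF True] by (simp add: r_def S_def field_simps)
      then show ?thesis by (simp add: ev)
    next
      case False
      then have "r g0 * (z \<bullet> w g) \<le> 0" using g r0 by (intro mult_nonneg_nonpos) (auto simp: S_def)
      then show ?thesis using y g by (force simp: ev feasible_def)
    qed
  qed
  have sub: "?Z \<subseteq> tight_set G w b y'"
    using z(1) by (auto simp: tight_set_def ev span_base)
  have g0t: "g0 \<in> tight_set G w b y'"
    using g0(1) by (auto simp: tight_set_def ev r_def S_def)
  have "w g0 \<notin> span (w ` ?Z)" using z(1) g0(1) by (auto simp: S_def)
  then have "dim (w ` ?Z) < dim (insert (w g0) (w ` ?Z))"
    by (simp add: dim_insert)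
  also have "\<dots> \<le> dim (w ` tight_set G w b y')"
    using sub g0t by (intro dim_subset) auto
  finally show ?thesis using feas z(2) r0 ev by auto
qed

text \<open>The rank of a tight set is bounded by the dimension of the space, so it is maximal at
  some feasible point that is at least as good as \<open>y\<close>; there the previous lemma leaves
  only full span.\<close>

lemma feasible_vertex_exists:
  fixes w :: "'i \<Rightarrow> 'e::euclidean_space"
  assumes G: "finite G" and y: "feasible G w b y"
    and p: "p = (\<Sum>g\<in>G. c g *\<^sub>R w g)" and c: "\<And>g. g \<in> G \<Longrightarrow> 0 \<le> c g"
  shows "\<exists>y'. feasible G w b y' \<and> y \<bullet> p \<le> y' \<bullet> p \<and> span (w ` tight_set G w b y') = span (w ` G)"
proof -
  let ?P = "\<lambda>y'. feasible G w b y' \<and> y \<bullet> p \<le> y' \<bullet> p"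
  let ?f = "\<lambda>y'. dim (w ` tight_set G w b y')"
  have "\<forall>y'. ?P y' \<longrightarrow> ?f y' < Suc DIM('e)" using dim_subset_UNIV[where 'a='e] by (simp add: less_Suc_eq_le)
  then obtain y' where y': "?P y'" "\<And>x. ?P x \<Longrightarrow> ?f x \<le> ?f y'"
    using ex_has_greatest_nat[of ?P y ?f "Suc DIM('e)"] y by (metis order_refl)
  have "span (w ` tight_set G w b y') = span (w ` G)"
  proof (rule ccontr)
    assume "\<not> ?thesis"
    then obtain y2 where "feasible G w b y2" "y' \<bullet> p \<le> y2 \<bullet> p" "?f y' < ?f y2"
      using feasible_raise_dim_tight[OF G _ p c] y'(1) by metis
    then show False using y' by (meson dual_order.trans leD)
  qed
  then show ?thesis using y' by blast
qed

section \<open>Generic perturbation of the heights\<close>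

lemma independent_family_zero:
  fixes w :: "'i \<Rightarrow> 'e::euclidean_space"
  assumes "finite \<tau>" "inj_on w \<tau>" "independent (w ` \<tau>)" "(\<Sum>g\<in>\<tau>. c g *\<^sub>R w g) = 0" "g \<in> \<tau>"
  shows "c g = 0"
proof -
  have "(\<Sum>x\<in>w ` \<tau>. c (the_inv_into \<tau> w x) *\<^sub>R x) = 0"
    using assms(2,4) by (simp add: sum.reindex the_inv_into_f_f)
  moreover have "w g \<in> w ` \<tau>" using assms(5) by simp
  ultimately have "c (the_inv_into \<tau> w (w g)) = 0"
    by (rule independentD[OF assms(3) finite_imageI[OF assms(1)] subset_refl])
  then show ?thesis using assms(2,5) by (simp add: the_inv_into_f_f)
qed

text \<open>The last clause lets strict inequalities for \<open>b'\<close> survive as weak ones for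
  \<open>b\<close>; this is how the triangulation will refine the subdivision given by
  \<open>b\<close>. Only finitely many pairs \<open>(\<tau>, h)\<close> occur, and each determines
  its coefficients \<open>c\<close> on \<tau>.\<close>

lemma generic_perturbation:
  fixes w :: "'i \<Rightarrow> 'e::euclidean_space"
  assumes G: "finite G"
  shows "\<exists>b'. generic G w b' \<and> (\<forall>g\<in>G. b g \<le> b' g) \<and>
    (\<forall>\<tau> h c. basis_family G w \<tau> \<longrightarrow> h \<in> G - \<tau> \<longrightarrow> w h = (\<Sum>g\<in>\<tau>. c g *\<^sub>R w g) \<longrightarrow>
       (\<Sum>g\<in>\<tau>. c g * b' g) < b' h \<longrightarrow> (\<Sum>g\<in>\<tau>. c g * b g) \<le> b h)"
proof -
  obtain i0 :: "'i \<Rightarrow> nat" where i0: "inj_on i0 G" using finite_imp_inj_to_nat_seg[OF G] by blast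
  \<comment> \<open>Exponents start at 1, so the constant term of the polynomial \<open>q\<close>
    below depends on \<open>b\<close> alone.\<close>
  define e where "e g = Suc (i0 g)" for g
  have e: "inj_on e G" using i0 by (auto simp: e_def inj_on_def)
  \<comment> \<open>Distinct powers of a small \<open>t > 0\<close>: each affine relation among the heights becomes a nonzero
    polynomial in \<open>t\<close>, and its sign for small \<open>t\<close> agrees with that of a nonzero constant term.\<close>
  define b' where "b' t g = b g + t ^ e g" for t :: real and g
  define K where "K = {(\<tau>, h). basis_family G w \<tau> \<and> h \<in> G - \<tau>}"
  have fK: "finite K"
    by (rule finite_subset[of _ "Pow G \<times> G"]) (use G in \<open>auto simp: K_def basis_family_def\<close>)
  define good where "good t \<tau> h \<longleftrightarrow> (\<forall>c. w h = (\<Sum>g\<in>\<tau>. c g *\<^sub>R w g) \<longrightarrow>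
      b' t h \<noteq> (\<Sum>g\<in>\<tau>. c g * b' t g) \<and>
      ((\<Sum>g\<in>\<tau>. c g * b' t g) < b' t h \<longrightarrow> (\<Sum>g\<in>\<tau>. c g * b g) \<le> b h))" for t \<tau> h
  have ev: "eventually (\<lambda>t. good t \<tau> h) (at_right 0)" if k: "(\<tau>, h) \<in> K" for \<tau> h
  proof (cases "\<exists>c. w h = (\<Sum>g\<in>\<tau>. c g *\<^sub>R w g)")
    case False then show ?thesis by (auto simp: good_def)
  next
    case True
    then obtain c where c: "w h = (\<Sum>g\<in>\<tau>. c g *\<^sub>R w g)" by blast
    have \<tau>: "\<tau> \<subseteq> G" "finite \<tau>" "inj_on w \<tau>" "independent (w ` \<tau>)" "h \<in> G" "h \<notin> \<tau>"
      using k finite_subset[OF _ G] by (auto simp: K_def basis_family_def)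
    have uniq: "c' g = c g" if "w h = (\<Sum>g\<in>\<tau>. c' g *\<^sub>R w g)" "g \<in> \<tau>" for c' g
    proof -
      have "(\<Sum>g\<in>\<tau>. (c' g - c g) *\<^sub>R w g) = 0"
        using that(1) c by (simp add: scaleR_diff_left sum_subtractf)
      from independent_family_zero[OF \<tau>(2-4) this that(2)] show ?thesis by simp
    qed
    define \<delta> where "\<delta> = b h - (\<Sum>g\<in>\<tau>. c g * b g)"
    define q where "q = [:\<delta>:] + monom 1 (e h) - (\<Sum>g\<in>\<tau>. monom (c g) (e g))"
    have pq: "poly q t = b' t h - (\<Sum>g\<in>\<tau>. c g * b' t g)" for t
      by (simp add: q_def \<delta>_def b'_def poly_monom poly_sum sum.distrib algebra_simps)
    \<comment> \<open>\<open>e\<close> is injective and \<open>h\<close> lies outside \<tau>, so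
      nothing else contributes at degree \<open>e h\<close>, which is positive and hence misses the
      constant \<delta>.\<close>
    have "coeff q (e h) = 1"
    proof -
      have "e g \<noteq> e h" if "g \<in> \<tau>" for g using that \<tau> e by (metis inj_onD subsetD)
      then have "(\<Sum>g\<in>\<tau>. coeff (monom (c g) (e g)) (e h)) = 0" by (intro sum.neutral) auto
      then show ?thesis by (simp add: q_def coeff_sum e_def coeff_pCons)
    qed
    then have "q \<noteq> 0" by auto
    then have "finite {x. poly q x = 0}" by (rule poly_roots_finite)
    then have "eventually (\<lambda>t. \<forall>x\<in>{x. poly q x = 0}. t \<noteq> x) (at_right 0)"
      by (subst eventually_ball_finite_distrib) (auto intro!: eventually_neq_at_within)
    then have 1: "eventually (\<lambda>t. poly q t \<noteq> 0) (at_right 0)"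
      by eventually_elim auto
    have "poly q 0 = \<delta>" 
      by (simp add: pq b'_def \<delta>_def e_def)
    then have "((\<lambda>t. poly q t) \<longlongrightarrow> \<delta>) (at_right 0)"
      using tendsto_within_subset[OF poly_isCont[of 0 q, unfolded isCont_def], of "{0<..}"] by simp
    \<comment> \<open>A negative \<delta> makes \<open>q\<close> negative near 0, which refutes the
      premise of the second part of \<open>good\<close>; for \<delta> at least 0 the conclusion of
      that part holds outright.\<close>
    then have 2: "eventually (\<lambda>t. \<delta> < 0 \<longrightarrow> poly q t < 0) (at_right 0)"
      by (cases "\<delta> < 0") (auto dest: order_tendstoD(2))
    show ?thesis
      using 1 2
    proof eventually_elim
      case (elim t)
      show ?case unfolding good_def
      proof (intro allI impI)
        fix c' assume c': "w h = (\<Sum>g\<in>\<tau>. c' g *\<^sub>R w g)"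
        have "(\<Sum>g\<in>\<tau>. c' g * x g) = (\<Sum>g\<in>\<tau>. c g * x g)" for x :: "'i \<Rightarrow> real"
          using uniq[OF c'] by (intro sum.cong) auto
        then show "b' t h \<noteq> (\<Sum>g\<in>\<tau>. c' g * b' t g) \<and>
          ((\<Sum>g\<in>\<tau>. c' g * b' t g) < b' t h \<longrightarrow> (\<Sum>g\<in>\<tau>. c' g * b g) \<le> b h)"
          using elim by (auto simp: pq \<delta>_def)
      qed
    qed
  qed
  have "eventually (\<lambda>t. \<forall>k\<in>K. good t (fst k) (snd k)) (at_right 0)"
    using ev fK by (subst eventually_ball_finite_distrib) auto
  moreover have "eventually (\<lambda>t::real. t > 0) (at_right 0)" by (simp add: eventually_at_right_less)
  ultimately have "eventually (\<lambda>t. t > 0 \<and> (\<forall>k\<in>K. good t (fst k) (snd k))) (at_right (0::real))"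
    by eventually_elim auto
  then obtain t :: real where "t > 0" and gd: "\<And>\<tau> h. (\<tau>, h) \<in> K \<Longrightarrow> good t \<tau> h"
    using eventually_happens[of _ "at_right (0::real)"] by (force simp: trivial_limit_at_right_real)
  show ?thesis
  proof (intro exI[of _ "b' t"] conjI)
    show "generic G w (b' t)" unfolding generic_def using gd by (auto simp: good_def K_def)
    show "\<forall>g\<in>G. b g \<le> b' t g" using \<open>t > 0\<close> by (simp add: b'_def)
  qed (use gd in \<open>force simp: good_def K_def\<close>)
qed

section \<open>Interpolation and linear programming duality\<close>

lemma independent_interpolation:
  fixes w :: "'i \<Rightarrow> 'e::euclidean_space"
  assumes "inj_on w \<tau>" "independent (w ` \<tau>)"
  shows "\<exists>y. \<forall>g\<in>\<tau>. y \<bullet> w g = b g"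
proof -
  obtain f :: "'e \<Rightarrow> real" where f: "linear f" "\<forall>x\<in>w ` \<tau>. f x = b (the_inv_into \<tau> w x)"
    using linear_independent_extend[OF assms(2), of "\<lambda>x. b (the_inv_into \<tau> w x)"] by auto
  \<comment> \<open>\<open>adjoint f 1\<close> is the vector that represents the functional
    \<open>f\<close> through the inner product.\<close>
  have "adjoint f 1 \<bullet> w g = b g" if "g \<in> \<tau>" for g
    using f that assms(1) adjoint_works[OF f(1), of "w g" 1] by (simp add: the_inv_into_f_f inner_commute)
  then show ?thesis by blast
qed

lemma span_image_finite_sum:
  fixes w :: "'i \<Rightarrow> 'e::euclidean_space"
  assumes "finite \<tau>" "inj_on w \<tau>" "x \<in> span (w ` \<tau>)"
  shows "\<exists>c. x = (\<Sum>g\<in>\<tau>. c g *\<^sub>R w g)"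
proof -
  obtain u where "(\<Sum>v\<in>w ` \<tau>. u v *\<^sub>R v) = x"
    using assms(3) unfolding span_finite[OF finite_imageI[OF assms(1)]] by blast
  then have "x = (\<Sum>g\<in>\<tau>. u (w g) *\<^sub>R w g)" using assms(2) by (simp add: sum.reindex)
  then show ?thesis by (rule exI[of _ "\<lambda>g. u (w g)"])
qed

text \<open>A tight index outside a basis chosen within the tight set would have its height given by
  the same linear relation as its vector, against genericity.\<close>

lemma basis_family_tight:
  fixes w :: "'i \<Rightarrow> 'e::euclidean_space"
  assumes G: "finite G" and gen: "generic G w b"
    and sp: "span (w ` tight_set G w b y) = span (w ` G)"
  shows "basis_family G w (tight_set G w b y)"
proof -
  obtain B where B: "B \<subseteq> w ` tight_set G w b y" "independent B" "w ` tight_set G w b y \<subseteq> span B"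
    using maximal_independent_subset by blast
  obtain \<tau> where \<tau>: "\<tau> \<subseteq> tight_set G w b y" "inj_on w \<tau>" "B = w ` \<tau>"
    using subset_image_inj[THEN iffD1, OF B(1)] by blast
  have "span (w ` \<tau>) = span (w ` G)"
    using span_mono[OF B(1)] span_minimal[OF B(3) subspace_span] sp \<tau>(3) by simp
  then have bas: "basis_family G w \<tau>"
    using \<tau> B by (auto simp: basis_family_def tight_set_def)
  have "tight_set G w b y = \<tau>"
  proof (rule ccontr)
    assume "\<not> ?thesis"
    then obtain h where h: "h \<in> tight_set G w b y" "h \<notin> \<tau>" using \<tau> by auto
    have fin: "finite \<tau>" using G \<tau> by (auto simp: tight_set_def intro: finite_subset)
    obtain c where c: "w h = (\<Sum>g\<in>\<tau>. c g *\<^sub>R w g)"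
      using span_image_finite_sum[OF fin \<tau>(2)] B(3) h(1) \<tau>(3) by blast
    have "b h = y \<bullet> w h" using h by (simp add: tight_set_def)
    also have "\<dots> = (\<Sum>g\<in>\<tau>. c g * (y \<bullet> w g))" by (simp add: c inner_sum_right)
    also have "\<dots> = (\<Sum>g\<in>\<tau>. c g * b g)" using \<tau>(1) by (intro sum.cong) (auto simp: tight_set_def)
    finally show False using gen bas h c unfolding generic_def by (auto simp: tight_set_def)
  qed
  then show ?thesis using bas by simp
qed

text \<open>The equality says that the nonnegative terms
  \<open>c g * (b g - y \<bullet> w g)\<close> sum to zero, so each vanishes.\<close>

lemma complementary_slackness:
  fixes w :: "'i \<Rightarrow> 'e::euclidean_space"
  assumes "finite \<sigma>" "\<sigma> \<subseteq> G" "feasible G w b y"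
    and "\<And>g. g \<in> \<sigma> \<Longrightarrow> 0 \<le> c g" and "y \<bullet> (\<Sum>g\<in>\<sigma>. c g *\<^sub>R w g) = (\<Sum>g\<in>\<sigma>. c g * b g)"
    and g: "g \<in> \<sigma>" "0 < c g"
  shows "g \<in> tight_set G w b y"
proof -
  have "(\<Sum>g\<in>\<sigma>. c g * (b g - y \<bullet> w g)) = 0"
    using assms(5) by (simp add: inner_sum_right right_diff_distrib sum_subtractf)
  moreover have "0 \<le> c g * (b g - y \<bullet> w g)" if "g \<in> \<sigma>" for g
    using that assms by (auto simp: feasible_def)
  ultimately have "c g * (b g - y \<bullet> w g) = 0"
    using sum_nonneg_eq_0_iff[OF assms(1), of "\<lambda>g. c g * (b g - y \<bullet> w g)"] g(1) by auto
  then show ?thesis using g assms(2) by (auto simp: tight_set_def)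
qed

lemma weak_duality:
  fixes w :: "'i \<Rightarrow> 'e::euclidean_space"
  assumes "\<sigma> \<subseteq> G" "feasible G w b y" "\<And>g. g \<in> \<sigma> \<Longrightarrow> 0 \<le> c g"
  shows "y \<bullet> (\<Sum>g\<in>\<sigma>. c g *\<^sub>R w g) \<le> (\<Sum>g\<in>\<sigma>. c g * b g)"
  using assms by (auto simp: inner_sum_right feasible_def intro!: sum_mono mult_left_mono)

lemma tight_duality:
  fixes w :: "'i \<Rightarrow> 'e::euclidean_space"
  assumes "\<sigma> \<subseteq> tight_set G w b y"
  shows "y \<bullet> (\<Sum>g\<in>\<sigma>. c g *\<^sub>R w g) = (\<Sum>g\<in>\<sigma>. c g * b g)"
  using assms by (auto simp: inner_sum_right tight_set_def intro!: sum.cong)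

section \<open>The triangulation and the count of its faces\<close>

text \<open>\<open>T\<close> consists of the tight sets of the vertices for the perturbed heights.
  Genericity makes them bases, duality separates their open cones, and a vertex maximising the
  objective \<open>p\<close> yields a closed cone that contains \<open>p\<close>.\<close>

lemma regular_cone_triangulation:
  fixes w :: "'i \<Rightarrow> 'e::euclidean_space"
  assumes G: "finite G" and y0: "feasible G w b y0"
  obtains T where
    "finite T"
    "\<And>\<tau>. \<tau> \<in> T \<Longrightarrow> basis_family G w \<tau>"
    "\<And>\<tau>. \<tau> \<in> T \<Longrightarrow> \<exists>y. feasible G w b y \<and> \<tau> \<subseteq> tight_set G w b y"
    "\<And>\<tau> \<tau>' c c'. \<lbrakk>\<tau> \<in> T; \<tau>' \<in> T; \<And>g. g \<in> \<tau> \<Longrightarrow> 0 < c g; \<And>g. g \<in> \<tau>' \<Longrightarrow> 0 < c' g;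
       (\<Sum>g\<in>\<tau>. c g *\<^sub>R w g) = (\<Sum>g\<in>\<tau>'. c' g *\<^sub>R w g)\<rbrakk> \<Longrightarrow> \<tau> = \<tau>'"
    "\<And>c. (\<And>g. g \<in> G \<Longrightarrow> 0 \<le> c g) \<Longrightarrow>
       \<exists>\<tau>\<in>T. \<exists>c'. (\<forall>g\<in>\<tau>. 0 \<le> c' g) \<and> (\<Sum>g\<in>G. c g *\<^sub>R w g) = (\<Sum>g\<in>\<tau>. c' g *\<^sub>R w g)"
proof -
  obtain b' where gen: "generic G w b'" and bb': "\<And>g. g \<in> G \<Longrightarrow> b g \<le> b' g"
    and lim: "\<And>\<tau> h c. \<lbrakk>basis_family G w \<tau>; h \<in> G - \<tau>; w h = (\<Sum>g\<in>\<tau>. c g *\<^sub>R w g);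
       (\<Sum>g\<in>\<tau>. c g * b' g) < b' h\<rbrakk> \<Longrightarrow> (\<Sum>g\<in>\<tau>. c g * b g) \<le> b h"
    using generic_perturbation[OF G, of w b] by blast
  define V where "V = {y. feasible G w b' y \<and> span (w ` tight_set G w b' y) = span (w ` G)}"
  define T where "T = tight_set G w b' ` V"
  have y0': "feasible G w b' y0" using y0 bb' by (force simp: feasible_def)
  have finT: "finite T"
    by (rule finite_subset[of _ "Pow G"]) (use G in \<open>auto simp: T_def tight_set_def\<close>)
  have bas: "basis_family G w (tight_set G w b' y)" if "y \<in> V" for y
    using basis_family_tight[OF G gen] that by (auto simp: V_def)
  have finb: "finite \<tau>" if "basis_family G w \<tau>" for \<tau>
    using that G by (auto simp: basis_family_def intro: finite_subset)
  show thesis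
  proof (rule that[of T])
    show "finite T" by (rule finT)
    show "basis_family G w \<tau>" if "\<tau> \<in> T" for \<tau> using that bas by (auto simp: T_def)
    show "\<exists>y. feasible G w b y \<and> \<tau> \<subseteq> tight_set G w b y" if \<tau>T: "\<tau> \<in> T" for \<tau>
    proof -
      obtain y' where y': "y' \<in> V" "\<tau> = tight_set G w b' y'" using \<tau>T by (auto simp: T_def)
      have bt: "basis_family G w \<tau>" using bas y' by simp
      \<comment> \<open>\<open>y\<close> interpolates the unperturbed heights on \<tau>. At an index
        off \<tau> the perturbed constraint is strict at \<open>y'\<close>, and \<open>lim\<close>
        turns this into the weak constraint for \<open>b\<close>.\<close>
      obtain y where y: "\<forall>g\<in>\<tau>. y \<bullet> w g = b g"
        using independent_interpolation[of w \<tau> b] bt by (auto simp: basis_family_def)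
      have "y \<bullet> w h \<le> b h" if h: "h \<in> G" for h
      proof (cases "h \<in> \<tau>")
        case False
        have "w h \<in> span (w ` \<tau>)" using bt h by (simp add: basis_family_def span_base)
        then obtain c where c: "w h = (\<Sum>g\<in>\<tau>. c g *\<^sub>R w g)"
          using span_image_finite_sum[OF finb[OF bt]] bt by (metis basis_family_def)
        have "(\<Sum>g\<in>\<tau>. c g * b' g) = y' \<bullet> w h"
          using tight_duality[of \<tau> G w b' y' c] y' c by simp
        also have "\<dots> < b' h" using False h y' by (force simp: tight_set_def V_def feasible_def)
        finally have "(\<Sum>g\<in>\<tau>. c g * b g) \<le> b h" using lim[OF bt _ c] False h by blast
        moreover have "y \<bullet> w h = (\<Sum>g\<in>\<tau>. c g * b g)"
          using y by (simp add: c inner_sum_right)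
        ultimately show ?thesis by simp
      qed (use y in auto)
      then show ?thesis using y bt by (intro exI[of _ y]) (auto simp: feasible_def tight_set_def basis_family_def)
    qed
    show "\<tau> = \<tau>'" if T: "\<tau> \<in> T" "\<tau>' \<in> T" and c: "\<And>g. g \<in> \<tau> \<Longrightarrow> 0 < c g" "\<And>g. g \<in> \<tau>' \<Longrightarrow> 0 < c' g"
      and eq: "(\<Sum>g\<in>\<tau>. c g *\<^sub>R w g) = (\<Sum>g\<in>\<tau>'. c' g *\<^sub>R w g)" for \<tau> \<tau>' c c'
    proof -
      obtain y y' where y: "y \<in> V" "\<tau> = tight_set G w b' y" "y' \<in> V" "\<tau>' = tight_set G w b' y'"
        using T by (auto simp: T_def)
      have sub: "\<tau> \<subseteq> G" "\<tau>' \<subseteq> G" and fin: "finite \<tau>" "finite \<tau>'"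
        using y G by (auto simp: tight_set_def)
      have f: "feasible G w b' y" "feasible G w b' y'" using y by (auto simp: V_def)
      have 1: "y \<bullet> (\<Sum>g\<in>\<tau>. c g *\<^sub>R w g) = (\<Sum>g\<in>\<tau>. c g * b' g)"
        and 2: "y' \<bullet> (\<Sum>g\<in>\<tau>'. c' g *\<^sub>R w g) = (\<Sum>g\<in>\<tau>'. c' g * b' g)"
        using y by (auto intro: tight_duality)
      have 3: "y' \<bullet> (\<Sum>g\<in>\<tau>. c g *\<^sub>R w g) \<le> (\<Sum>g\<in>\<tau>. c g * b' g)"
        and 4: "y \<bullet> (\<Sum>g\<in>\<tau>'. c' g *\<^sub>R w g) \<le> (\<Sum>g\<in>\<tau>'. c' g * b' g)"
        using weak_duality[OF sub(1) f(2), of c] weak_duality[OF sub(2) f(1), of c'] c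
        by (auto simp: less_imp_le)
      \<comment> \<open>At the common point each of the two values bounds the other by weak duality,
        so all four coincide; slackness then forces each simplex into the other.\<close>
      have e1: "y' \<bullet> (\<Sum>g\<in>\<tau>. c g *\<^sub>R w g) = (\<Sum>g\<in>\<tau>. c g * b' g)"
        and e2: "y \<bullet> (\<Sum>g\<in>\<tau>'. c' g *\<^sub>R w g) = (\<Sum>g\<in>\<tau>'. c' g * b' g)"
        using 1 2 3 4 unfolding eq by linarith+
      have "\<tau> \<subseteq> \<tau>'"
        using complementary_slackness[OF fin(1) sub(1) f(2) _ e1] c(1) y(4) less_imp_le by blast
      moreover have "\<tau>' \<subseteq> \<tau>"
        using complementary_slackness[OF fin(2) sub(2) f(1) _ e2] c(2) y(2) less_imp_le by blast
      ultimately show ?thesis by simp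
    qed
    show "\<exists>\<tau>\<in>T. \<exists>c'. (\<forall>g\<in>\<tau>. 0 \<le> c' g) \<and> (\<Sum>g\<in>G. c g *\<^sub>R w g) = (\<Sum>g\<in>\<tau>. c' g *\<^sub>R w g)"
      if c: "\<And>g. g \<in> G \<Longrightarrow> 0 \<le> c g" for c
    proof -
      define p where "p = (\<Sum>g\<in>G. c g *\<^sub>R w g)"
      have vert: "\<exists>y'\<in>V. y \<bullet> p \<le> y' \<bullet> p" if "feasible G w b' y" for y
        using feasible_vertex_exists[OF G that p_def c] by (auto simp: V_def)
      \<comment> \<open>The objective at a vertex depends only on its tight set, since
        \<open>p\<close> is a combination of the tight vectors. Hence it can be maximised over the
        finite set \<open>T\<close>, whichever vertex the choice returns.\<close>
      define val where "val \<tau> = (SOME y. y \<in> V \<and> tight_set G w b' y = \<tau>) \<bullet> p" for \<tau>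
      have val: "val (tight_set G w b' y) = y \<bullet> p" if yV: "y \<in> V" for y
      proof -
        define y2 where "y2 = (SOME y2. y2 \<in> V \<and> tight_set G w b' y2 = tight_set G w b' y)"
        have y2: "y2 \<in> V \<and> tight_set G w b' y2 = tight_set G w b' y"
          unfolding y2_def by (rule someI[of _ y]) (use yV in simp)
        let ?\<tau> = "tight_set G w b' y"
        have "p \<in> span (w ` ?\<tau>)"
          using yV by (simp add: V_def p_def span_sum span_scale span_base)
        then obtain d where d: "p = (\<Sum>g\<in>?\<tau>. d g *\<^sub>R w g)"
          using span_image_finite_sum[OF finb[OF bas[OF yV]]] bas[OF yV] by (metis basis_family_def)
        have "y \<bullet> p = (\<Sum>g\<in>?\<tau>. d g * b' g)" "y2 \<bullet> p = (\<Sum>g\<in>?\<tau>. d g * b' g)"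
          unfolding d using y2 by (auto intro: tight_duality)
        then show ?thesis by (simp add: val_def y2_def)
      qed
      have Tne: "T \<noteq> {}" using vert[OF y0'] by (auto simp: T_def)
      obtain \<tau> where \<tau>: "\<tau> \<in> T" "\<And>\<sigma>. \<sigma> \<in> T \<Longrightarrow> val \<sigma> \<le> val \<tau>"
        using ex_is_arg_min_if_finite[OF finT Tne, of "\<lambda>\<sigma>. - val \<sigma>"] by (auto simp: is_arg_min_linorder)
      obtain y where y: "y \<in> V" "\<tau> = tight_set G w b' y" using \<tau> by (auto simp: T_def)
      have bt: "basis_family G w \<tau>" using bas y by simp
      have best: "y' \<bullet> p \<le> y \<bullet> p" if f: "feasible G w b' y'" for y'
      proof -
        obtain y2 where "y2 \<in> V" "y' \<bullet> p \<le> y2 \<bullet> p" using vert[OF f] by blast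
        then show ?thesis using \<tau>(2)[of "tight_set G w b' y2"] val y by (force simp: T_def)
      qed
      have "p \<in> span (w ` \<tau>)"
        using bt by (simp add: basis_family_def p_def span_sum span_scale span_base)
      then obtain d where d: "p = (\<Sum>g\<in>\<tau>. d g *\<^sub>R w g)"
        using span_image_finite_sum[OF finb[OF bt]] bt by (metis basis_family_def)
      \<comment> \<open>If \<open>d g\<close> were negative, moving along a direction
        \<open>z\<close> that loosens only the constraint \<open>g\<close> would raise the
        objective. Constraints off \<tau> are strict at \<open>y\<close>, so a small step stays
        feasible, against the optimality of \<open>y\<close>.\<close>
      have "0 \<le> d g" if g: "g \<in> \<tau>" for g
      proof (rule ccontr)
        assume neg: "\<not> 0 \<le> d g"
        obtain z where z: "\<forall>h\<in>\<tau>. z \<bullet> w h = (if h = g then -1 else 0)"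
          using independent_interpolation[of w \<tau> "\<lambda>h. if h = g then -1 else 0"] bt
          by (auto simp: basis_family_def)
        have "z \<bullet> p = (\<Sum>h\<in>\<tau>. if h = g then - d h else 0)"
          unfolding d inner_sum_right by (rule sum.cong) (use z in auto)
        also have "\<dots> = - d g" using g finb[OF bt] by simp
        finally have zp: "z \<bullet> p > 0" using neg by simp
        have "eventually (\<lambda>\<epsilon>. \<forall>h\<in>G. (y + \<epsilon> *\<^sub>R z) \<bullet> w h \<le> b' h) (at_right 0)"
        proof (subst eventually_ball_finite_distrib[OF G], intro ballI)
          fix h assume h: "h \<in> G"
          show "eventually (\<lambda>\<epsilon>. (y + \<epsilon> *\<^sub>R z) \<bullet> w h \<le> b' h) (at_right 0)"
          proof (cases "h \<in> \<tau>")
            case True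
            have "eventually (\<lambda>\<epsilon>::real. \<epsilon> > 0) (at_right 0)" by (simp add: eventually_at_right_less)
            then show ?thesis
              by eventually_elim (use True y z in \<open>auto simp: inner_add_left tight_set_def\<close>)
          next
            case False
            then have "y \<bullet> w h < b' h" using h y by (force simp: V_def feasible_def tight_set_def)
            moreover have "((\<lambda>\<epsilon>. (y + \<epsilon> *\<^sub>R z) \<bullet> w h) \<longlongrightarrow> (y + 0 *\<^sub>R z) \<bullet> w h) (at_right 0)"
              by (intro tendsto_intros)
            ultimately have "eventually (\<lambda>\<epsilon>. (y + \<epsilon> *\<^sub>R z) \<bullet> w h < b' h) (at_right 0)"
              by (intro order_tendstoD(2)[of _ "(y + 0 *\<^sub>R z) \<bullet> w h"]) auto
            then show ?thesis by eventually_elim simp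
          qed
        qed
        moreover have "eventually (\<lambda>\<epsilon>::real. \<epsilon> > 0) (at_right 0)" by (simp add: eventually_at_right_less)
        ultimately have "eventually (\<lambda>\<epsilon>. \<epsilon> > 0 \<and> feasible G w b' (y + \<epsilon> *\<^sub>R z)) (at_right 0)"
          by eventually_elim (simp add: feasible_def)
        then obtain \<epsilon> :: real where "\<epsilon> > 0" "feasible G w b' (y + \<epsilon> *\<^sub>R z)"
          using eventually_happens[of _ "at_right (0::real)"] by (force simp: trivial_limit_at_right_real)
        then have "\<epsilon> * (z \<bullet> p) \<le> 0" using best[of "y + \<epsilon> *\<^sub>R z"] by (simp add: inner_add_left)
        then show False using \<open>\<epsilon> > 0\<close> zp by (simp add: mult_le_0_iff)
      qed
      then show ?thesis using \<tau>(1) d by (auto simp: p_def)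
    qed
  qed
qed

text \<open>A cell \<open>A\<close> can be recovered from a face \<open>S\<close> inside it whose
  span contains the sum over \<open>A\<close>: a feasible vector tight on \<open>S\<close> takes the
  value \<open>\<Sum>g\<in>A. b g\<close> at that sum, so it is tight on all of \<open>A\<close>.
  The functional \<open>e\<close> is positive on every vector and thereby excludes the empty
  face.\<close>

lemma card_cells_le:
  fixes w :: "'i \<Rightarrow> 'e::euclidean_space"
  assumes G: "finite G" and T: "finite T" and card: "\<And>\<tau>. \<tau> \<in> T \<Longrightarrow> card \<tau> = d" and TG: "\<And>\<tau>. \<tau> \<in> T \<Longrightarrow> \<tau> \<subseteq> G"
    and tight: "\<And>\<tau>. \<tau> \<in> T \<Longrightarrow> \<exists>y. feasible G w b y \<and> \<tau> \<subseteq> tight_set G w b y"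
    and cover: "\<And>c. (\<And>g. g \<in> G \<Longrightarrow> 0 \<le> c g) \<Longrightarrow>
       \<exists>\<tau>\<in>T. \<exists>c'. (\<forall>g\<in>\<tau>. 0 \<le> c' g) \<and> (\<Sum>g\<in>G. c g *\<^sub>R w g) = (\<Sum>g\<in>\<tau>. c' g *\<^sub>R w g)"
    and e: "\<And>g. g \<in> G \<Longrightarrow> 0 < e \<bullet> w g"
  shows "card (tight_set G w b ` {y. feasible G w b y} - {{}}) \<le> card T * (2 ^ d - 1)"
proof -
  let ?cells = "tight_set G w b ` {y. feasible G w b y} - {{}}"
  let ?faces = "\<Union>\<tau>\<in>T. Pow \<tau> - {{}}"
  let ?P = "\<lambda>A S. S \<in> ?faces \<and> S \<subseteq> A \<and> (\<exists>c. (\<Sum>g\<in>A. w g) = (\<Sum>g\<in>S. c g *\<^sub>R w g))"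
  have fin\<tau>: "finite \<tau>" if "\<tau> \<in> T" for \<tau> using TG[OF that] G finite_subset by blast
  have ex: "\<exists>S. ?P A S" if A: "A \<in> ?cells" for A
  proof -
    obtain y where y: "feasible G w b y" "A = tight_set G w b y" "A \<noteq> {}" using A by auto
    have AG: "A \<subseteq> G" "finite A" using y G by (auto simp: tight_set_def)
    have pA: "(\<Sum>g\<in>G. (if g \<in> A then 1 else 0) *\<^sub>R w g) = (\<Sum>g\<in>A. w g)"
      using AG G by (intro sum.mono_neutral_cong_right) auto
    \<comment> \<open>The cell is encoded by the smallest face of the triangulation containing its barycentre.\<close>
    obtain \<tau> c where \<tau>: "\<tau> \<in> T" and c: "\<forall>g\<in>\<tau>. 0 \<le> c g" and eq: "(\<Sum>g\<in>A. w g) = (\<Sum>g\<in>\<tau>. c g *\<^sub>R w g)"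
      using cover[of "\<lambda>g. if g \<in> A then 1 else 0"] unfolding pA by force
    obtain y' where y': "feasible G w b y'" "\<tau> \<subseteq> tight_set G w b y'" using tight[OF \<tau>] by blast
    \<comment> \<open>The chain closes into equalities, so \<open>y\<close> is optimal for the
      simplex \<tau> as well, and slackness puts each vertex of positive weight into
      \<open>A\<close>.\<close>
    have "(\<Sum>g\<in>\<tau>. c g * b g) = y' \<bullet> (\<Sum>g\<in>A. w g)" unfolding eq using tight_duality[OF y'(2)] by simp
    also have "\<dots> \<le> (\<Sum>g\<in>A. b g)" using weak_duality[OF AG(1) y'(1), of "\<lambda>_. 1"] by simp
    also have "\<dots> = y \<bullet> (\<Sum>g\<in>A. w g)" using tight_duality[of A G w b y "\<lambda>_. 1"] y by simp
    finally have "y \<bullet> (\<Sum>g\<in>\<tau>. c g *\<^sub>R w g) = (\<Sum>g\<in>\<tau>. c g * b g)"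
      using weak_duality[OF TG[OF \<tau>] y(1), of c] c eq by simp
    then have slack: "g \<in> A" if "g \<in> \<tau>" "0 < c g" for g
      using complementary_slackness[OF fin\<tau>[OF \<tau>] TG[OF \<tau>] y(1), of c g] c that y(2) by blast
    define S where "S = {g\<in>\<tau>. 0 < c g}"
    have eqS: "(\<Sum>g\<in>A. w g) = (\<Sum>g\<in>S. c g *\<^sub>R w g)"
      unfolding eq S_def using c fin\<tau>[OF \<tau>] by (intro sum.mono_neutral_right) (auto simp: not_less antisym)
    have "S \<noteq> {}"
    proof
      assume "S = {}"
      then have "e \<bullet> (\<Sum>g\<in>A. w g) = 0" using eqS by simp
      moreover have "e \<bullet> (\<Sum>g\<in>A. w g) > 0"
        unfolding inner_sum_right using AG y(3) e by (intro sum_pos) auto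
      ultimately show False by simp
    qed
    then show ?thesis using \<tau> slack eqS by (intro exI[of _ S]) (auto simp: S_def)
  qed
  define F where "F A = (SOME S. ?P A S)" for A
  have F: "?P A (F A)" if "A \<in> ?cells" for A unfolding F_def using someI_ex[OF ex[OF that]] .
  have sub: "A \<subseteq> A'" if A: "A \<in> ?cells" "A' \<in> ?cells" and eqF: "F A = F A'" for A A'
  proof -
    obtain y y' where y: "feasible G w b y" "A = tight_set G w b y" "feasible G w b y'" "A' = tight_set G w b y'"
      using A by auto
    have AG: "A \<subseteq> G" "finite A" using y G by (auto simp: tight_set_def)
    obtain c where c: "(\<Sum>g\<in>A. w g) = (\<Sum>g\<in>F A. c g *\<^sub>R w g)" using F[OF A(1)] by blast
    have FA: "F A \<subseteq> A" "F A \<subseteq> A'" using F[OF A(1)] F[OF A(2)] eqF by auto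
    have "y' \<bullet> (\<Sum>g\<in>A. w g) = (\<Sum>g\<in>F A. c g * b g)"
      unfolding c using FA y by (intro tight_duality) auto
    also have "\<dots> = y \<bullet> (\<Sum>g\<in>A. w g)"
      unfolding c using FA y by (intro tight_duality[symmetric]) auto
    also have "\<dots> = (\<Sum>g\<in>A. b g)" using tight_duality[of A G w b y "\<lambda>_. 1"] y by simp
    finally have "y' \<bullet> (\<Sum>g\<in>A. 1 *\<^sub>R w g) = (\<Sum>g\<in>A. 1 * b g)" by simp
    then show ?thesis
      using complementary_slackness[OF AG(2,1) y(3), of "\<lambda>_. 1"] y(4) by auto
  qed
  have "inj_on F ?cells" by (rule inj_onI) (use sub in \<open>metis subset_antisym\<close>)
  moreover have "F ` ?cells \<subseteq> ?faces" using F by blast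
  moreover have finF: "finite ?faces" using T fin\<tau> by auto
  ultimately have "card ?cells \<le> card ?faces" by (rule card_inj_on_le)
  \<comment> \<open>A face shared by several simplices is counted once for each of them.\<close>
  also have "\<dots> \<le> (\<Sum>\<tau>\<in>T. card (Pow \<tau> - {{}}))" using T by (rule card_UN_le)
  also have "\<dots> = (\<Sum>\<tau>\<in>T. 2 ^ d - 1)"
    using fin\<tau> card by (intro sum.cong) (auto simp: card_Diff_singleton card_Pow)
  finally show ?thesis by simp
qed

section \<open>Volumes of lattice simplices\<close>

text \<open>The library's change of variables for linear maps needs a well-ordered index type; \<open>'n idx\<close> is
  such a type with as many elements as \<open>'n\<close>.\<close>

typedef 'n idx = "{..<CARD('n::finite)}"
  using zero_less_card_finite by blast

instantiation idx :: (finite) wellorder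
begin

definition less_eq_idx :: "'a idx \<Rightarrow> 'a idx \<Rightarrow> bool" where
  "less_eq_idx i j \<longleftrightarrow> Rep_idx i \<le> Rep_idx j"

definition less_idx :: "'a idx \<Rightarrow> 'a idx \<Rightarrow> bool" where
  "less_idx i j \<longleftrightarrow> Rep_idx i < Rep_idx j"

instance
proof
  fix P :: "'a idx \<Rightarrow> bool" and i
  assume step: "\<And>i. (\<And>j. j < i \<Longrightarrow> P j) \<Longrightarrow> P i"
  show "P i"
    by (induction i rule: measure_induct_rule[of Rep_idx]) (auto intro: step simp: less_idx_def)
qed (auto simp: less_eq_idx_def less_idx_def Rep_idx_inject)

end

lemma bij_betw_Rep_idx: "bij_betw (Rep_idx :: 'n::finite idx \<Rightarrow> nat) UNIV {..<CARD('n)}"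
  by (metis bij_betw_def inj_on_def Rep_idx_inject type_definition.Rep_range type_definition_idx)

instance idx :: (finite) finite
  by standard (metis bij_betw_Rep_idx bij_betw_finite finite_lessThan)

section \<open>Lebesgue measure through coordinates and cylinders\<close>

definition vec_of :: "(nat \<Rightarrow> real) \<Rightarrow> real ^ 'n::finite idx" where
  "vec_of t = (\<chi> i. t (Rep_idx i))"

lemma vec_of_measurable [measurable]:
  "(vec_of :: _ \<Rightarrow> real ^ 'n::finite idx) \<in> borel_measurable (PiM {..<CARD('n)} (\<lambda>_. lborel :: real measure))"
proof (subst borel_measurable_euclidean_space, rule ballI)
  fix b :: "real ^ 'n idx" assume "b \<in> Basis"
  then obtain i where b: "b = axis i 1" by (auto simp: Basis_vec_def)
  have "(\<lambda>t. t (Rep_idx i)) \<in> measurable (PiM {..<CARD('n)} (\<lambda>_. lborel :: real measure)) lborel"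
    using Rep_idx[of i] by (rule measurable_component_singleton)
  then show "(\<lambda>t. vec_of t \<bullet> b) \<in> borel_measurable (PiM {..<CARD('n)} (\<lambda>_. lborel :: real measure))"
    by (simp add: b inner_axis vec_of_def)
qed

text \<open>\<open>vol_r\<close> measures sets of functions on an initial segment of the naturals,
  while linear images are measured on a vector type; this connects the two. Lebesgue measure is
  determined by boxes, and their preimages are products of intervals.\<close>

lemma lborel_eq_PiM_vec_of:
  "(lborel :: (real ^ 'n::finite idx) measure) = distr (PiM {..<CARD('n)} (\<lambda>_. lborel)) borel vec_of"
proof (rule lborel_eqI)
  let ?n = "CARD('n)"
  interpret product_sigma_finite "\<lambda>_::nat. lborel :: real measure" by standard
  fix l u :: "real ^ 'n idx"
  assume lu: "\<And>b. b \<in> Basis \<Longrightarrow> l \<bullet> b \<le> u \<bullet> b"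
  have lu': "l $ i \<le> u $ i" for i using lu[of "axis i 1"] by (auto simp: inner_axis Basis_vec_def)
  have inv: "Rep_idx (Abs_idx j :: 'n idx) = j" if "j < ?n" for j using that by (simp add: Abs_idx_inverse)
  have "vec_of -` box l u \<inter> space (PiM {..<?n} (\<lambda>_. lborel)) =
    PiE {..<?n} (\<lambda>j. {l $ Abs_idx j <..< u $ Abs_idx j})"
  proof (intro set_eqI iffI)
    fix t assume "t \<in> vec_of -` box l u \<inter> space (PiM {..<?n} (\<lambda>_. lborel))"
    then show "t \<in> PiE {..<?n} (\<lambda>j. {l $ Abs_idx j <..< u $ Abs_idx j})"
      using inv by (auto simp: space_PiM vec_of_def mem_box_cart PiE_iff) (metis inv)+
  next
    fix t assume t: "t \<in> PiE {..<?n} (\<lambda>j. {l $ Abs_idx j <..< u $ Abs_idx j})"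
    have "l $ i < t (Rep_idx i) \<and> t (Rep_idx i) < u $ i" for i
      using PiE_mem[OF t Rep_idx] by (simp add: Rep_idx_inverse)
    then show "t \<in> vec_of -` box l u \<inter> space (PiM {..<?n} (\<lambda>_. lborel))"
      using t by (auto simp: space_PiM vec_of_def mem_box_cart PiE_iff)
  qed
  then have "emeasure (distr (PiM {..<?n} (\<lambda>_. lborel)) borel vec_of) (box l u)
     = (\<Prod>j<?n. ennreal (u $ Abs_idx j - l $ Abs_idx j))"
    using lu' by (subst emeasure_distr) (auto simp: emeasure_PiM)
  also have "\<dots> = (\<Prod>i\<in>UNIV. ennreal (u $ i - l $ i))"
    using prod.reindex_bij_betw[OF bij_betw_Rep_idx[where 'n='n], of "\<lambda>j. ennreal (u $ Abs_idx j - l $ Abs_idx j)"]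
    by (simp add: Rep_idx_inverse)
  also have "\<dots> = ennreal (\<Prod>i\<in>UNIV. u $ i - l $ i)"
    using lu' by (intro prod_ennreal) auto
  also have "(\<Prod>i\<in>UNIV. u $ i - l $ i) = (\<Prod>b\<in>Basis. (u - l) \<bullet> b)"
    by (simp add: Basis_vec_def prod.reindex UNION_singleton_eq_range axis_eq_axis inj_on_def inner_axis)
  finally show "emeasure (distr (PiM {..<?n} (\<lambda>_. lborel)) borel vec_of) (box l u) = ennreal (\<Prod>b\<in>Basis. (u - l) \<bullet> b)" .
qed simp

text \<open>Meaningful for \<open>j < CARD('n)\<close>, where it inverts
  \<open>vec_of\<close>.\<close>

definition coord :: "real ^ 'n::finite idx \<Rightarrow> nat \<Rightarrow> real" where
  "coord q j = q $ Abs_idx j"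

text \<open>Multiplying by unit intervals in the coordinates from \<open>r\<close> on turns an \<open>r\<close>-dimensional volume
  into a volume in a space whose dimension is a type.\<close>

definition cylinder :: "nat \<Rightarrow> (nat \<Rightarrow> real) set \<Rightarrow> (real ^ 'n::finite idx) set" where
  "cylinder r B = {q. restrict (coord q) {..<r} \<in> B \<and> (\<forall>i. r \<le> Rep_idx i \<longrightarrow> q $ i \<in> {0..1})}"

lemma cylinder_borel:
  assumes "B \<in> sets (PiM {..<r} (\<lambda>_. lborel))"
  shows "(cylinder r B :: (real ^ 'n::finite idx) set) \<in> sets borel"
proof -
  have 1: "(\<lambda>q :: real ^ 'n idx. restrict (coord q) {..<r}) \<in> measurable borel (PiM {..<r} (\<lambda>_. lborel))"
    unfolding coord_def by (intro measurable_restrict) (auto simp: measurable_lborel2)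
  have 2: "{q :: real ^ 'n idx. \<forall>i. r \<le> Rep_idx i \<longrightarrow> q $ i \<in> {0..1}} \<in> sets borel"
    by measurable
  have "cylinder r B = ((\<lambda>q. restrict (coord q) {..<r}) -` B \<inter> space borel) \<inter>
      {q :: real ^ 'n idx. \<forall>i. r \<le> Rep_idx i \<longrightarrow> q $ i \<in> {0..1}}"
    by (auto simp: cylinder_def)
  then show ?thesis using measurable_sets[OF 1 assms] 2 by auto
qed

text \<open>Splitting the product measure after the first \<open>r\<close> coordinates turns the
  cylinder into a rectangle whose second side is a unit cube, of measure 1.\<close>

lemma emeasure_cylinder:
  assumes r: "r \<le> CARD('n)" and B: "B \<in> sets (PiM {..<r} (\<lambda>_. lborel))"
  shows "emeasure lborel (cylinder r B :: (real ^ 'n::finite idx) set) = emeasure (PiM {..<r} (\<lambda>_. lborel)) B"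
proof -
  let ?n = "CARD('n)" and ?I = "{..<r}" and ?J = "{r..<CARD('n)}" and ?X = "cylinder r B :: (real ^ 'n::finite idx) set"
  let ?L = "\<lambda>_::nat. lborel :: real measure"
  interpret product_sigma_finite ?L by standard
  interpret J: finite_product_sigma_finite ?L ?J by standard simp
  have IJ: "?I \<inter> ?J = {}" "?I \<union> ?J = {..<?n}" using r by auto
  have inv: "Rep_idx (Abs_idx j :: 'n idx) = j" if "j < ?n" for j using that by (simp add: Abs_idx_inverse)
  have lt: "Rep_idx (i :: 'n idx) < ?n" for i using Rep_idx[of i] by simp
  have mX: "?X \<in> sets borel" by (rule cylinder_borel[OF B])
  have mS: "vec_of -` ?X \<inter> space (PiM {..<?n} ?L) \<in> sets (PiM {..<?n} ?L)"
    using mX by (rule measurable_sets[OF vec_of_measurable])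
  have cv: "coord (vec_of t :: real ^ 'n idx) j = t j" if "j < ?n" for t j
    using that by (simp add: coord_def vec_of_def inv)
  have Jset: "PiE ?J (\<lambda>_. {0..1::real}) \<in> sets (PiM ?J ?L)" by (intro sets_PiM_I_finite) auto
  have Bsp: "B \<subseteq> space (PiM ?I ?L)" by (rule sets.sets_into_space[OF B])
  have pre: "merge ?I ?J -` (vec_of -` ?X \<inter> space (PiM {..<?n} ?L)) \<inter> space (PiM ?I ?L \<Otimes>\<^sub>M PiM ?J ?L)
      = B \<times> PiE ?J (\<lambda>_. {0..1::real})"
  proof (intro set_eqI iffI)
    fix z assume z: "z \<in> merge ?I ?J -` (vec_of -` ?X \<inter> space (PiM {..<?n} ?L)) \<inter> space (PiM ?I ?L \<Otimes>\<^sub>M PiM ?J ?L)"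
    obtain s t where st: "z = (s, t)" by (cases z)
    let ?m = "merge ?I ?J (s, t)"
    have s: "s \<in> space (PiM ?I ?L)" "t \<in> space (PiM ?J ?L)" and v: "vec_of ?m \<in> ?X"
      using z st by (auto simp: space_pair_measure)
    have "restrict (coord (vec_of ?m :: real ^ 'n idx)) ?I = s"
      using s r by (intro ext) (auto simp: cv merge_def space_PiM PiE_iff extensional_def)
    moreover have "t j \<in> {0..1}" if j: "j \<in> ?J" for j
    proof -
      have "(vec_of ?m :: real ^ 'n idx) $ Abs_idx j \<in> {0..1}"
        using v j inv[of j] unfolding cylinder_def by (metis (no_types, lifting) atLeastLessThan_iff mem_Collect_eq)
      then show ?thesis using j by (simp add: vec_of_def inv merge_def)
    qed
    ultimately show "z \<in> B \<times> PiE ?J (\<lambda>_. {0..1::real})"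
      using v s by (auto simp: st cylinder_def space_PiM PiE_iff)
  next
    fix z assume z: "z \<in> B \<times> PiE ?J (\<lambda>_. {0..1::real})"
    obtain s t where st: "z = (s, t)" by (cases z)
    let ?m = "merge ?I ?J (s, t)"
    have s: "s \<in> B" "s \<in> space (PiM ?I ?L)" "t \<in> PiE ?J (\<lambda>_. {0..1::real})" using z st Bsp by auto
    then have t: "t \<in> space (PiM ?J ?L)" by (auto simp: space_PiM PiE_iff)
    have sp: "z \<in> space (PiM ?I ?L \<Otimes>\<^sub>M PiM ?J ?L)" using s t st by (auto simp: space_pair_measure)
    have "restrict (coord (vec_of ?m :: real ^ 'n idx)) ?I = s"
      using s r by (intro ext) (auto simp: cv merge_def space_PiM PiE_iff extensional_def)
    moreover have "(vec_of ?m :: real ^ 'n idx) $ i \<in> {0..1}" if "r \<le> Rep_idx i" for i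
      using PiE_mem[OF s(3), of "Rep_idx i"] that lt[of i] by (simp add: vec_of_def merge_def)
    ultimately have "vec_of ?m \<in> ?X" using s(1) by (simp add: cylinder_def)
    moreover have "?m \<in> space (PiM {..<?n} ?L)"
      using measurable_space[OF measurable_merge, of z ?I ?L ?J] sp st IJ by simp
    ultimately show "z \<in> merge ?I ?J -` (vec_of -` ?X \<inter> space (PiM {..<?n} ?L)) \<inter> space (PiM ?I ?L \<Otimes>\<^sub>M PiM ?J ?L)"
      using sp st by simp
  qed
  have mm: "merge ?I ?J \<in> measurable (PiM ?I ?L \<Otimes>\<^sub>M PiM ?J ?L) (PiM {..<?n} ?L)"
    using measurable_merge[of ?I ?J ?L] unfolding IJ(2) .
  have "emeasure lborel ?X = emeasure (PiM {..<?n} ?L) (vec_of -` ?X \<inter> space (PiM {..<?n} ?L))"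
    using mX by (subst lborel_eq_PiM_vec_of) (simp add: emeasure_distr)
  also have "\<dots> = emeasure (distr (PiM ?I ?L \<Otimes>\<^sub>M PiM ?J ?L) (PiM {..<?n} ?L) (merge ?I ?J))
      (vec_of -` ?X \<inter> space (PiM {..<?n} ?L))"
    using distr_merge[OF IJ(1)] IJ(2) by simp
  also have "\<dots> = emeasure (PiM ?I ?L \<Otimes>\<^sub>M PiM ?J ?L) (B \<times> PiE ?J (\<lambda>_. {0..1::real}))"
    by (simp only: emeasure_distr[OF mm mS] pre)
  also have "\<dots> = emeasure (PiM ?I ?L) B * emeasure (PiM ?J ?L) (PiE ?J (\<lambda>_. {0..1::real}))"
    using B Jset by (rule J.emeasure_pair_measure_Times)
  also have "emeasure (PiM ?J ?L) (PiE ?J (\<lambda>_. {0..1::real})) = 1"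
    by (subst J.measure_times) auto
  finally show ?thesis by simp
qed

lemma sum_idx: "(\<Sum>i\<in>UNIV. f (Rep_idx (i :: 'n::finite idx))) = (\<Sum>j<CARD('n). f j)"
  by (rule sum.reindex_bij_betw[OF bij_betw_Rep_idx])

section \<open>Volumes of simplices\<close>

text \<open>The open simplex is taken because simplices of the triangulation are disjoint only where
  all barycentric coordinates are positive. It differs from the closed one, of volume
  \<open>1 / fact r\<close>, by pieces of hyperplanes, which are null sets.\<close>

lemma measure_unit_simplex_cylinder:
  assumes r: "r \<le> CARD('n::finite)"
  defines "D \<equiv> {s :: real ^ 'n idx. (\<forall>j<r. 0 < coord s j) \<and> (\<Sum>j<r. coord s j) < 1 \<and>
       (\<forall>i. r \<le> Rep_idx i \<longrightarrow> s $ i \<in> {0..1})}"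
  shows "D \<in> lmeasurable" "measure lebesgue D = 1 / fact r"
proof -
  let ?M = "PiM {..<r} (\<lambda>_. lborel :: real measure)"
  let ?B = "{t. (\<forall>j\<in>{..<r}. 0 \<le> t j) \<and> sum t {..<r} \<le> 1} \<inter> space ?M"
  let ?C = "cylinder r ?B :: (real ^ 'n idx) set"
  have "?B = PiE {..<r} (\<lambda>_. {0..}) \<inter> (\<lambda>t. sum t {..<r}) -` {..1} \<inter> space ?M"
    by (auto simp: space_PiM)
  also have "\<dots> \<in> sets ?M" by measurable
  finally have B: "?B \<in> sets ?M" .
  have em: "emeasure lborel ?C = ennreal (1 / fact r)"
    using emeasure_cylinder[OF r B] emeasure_std_simplex_aux[of "{..<r}" 1] by simp
  have Cb: "?C \<in> sets borel" by (rule cylinder_borel[OF B])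
  then have Cm: "?C \<in> lmeasurable"
    using em by (intro fmeasurableI) (auto simp: emeasure_completion main_part_sets)
  have mC: "measure lebesgue ?C = 1 / fact r"
    using em Cb by (simp add: measure_completion measure_def)
  have Ceq: "?C = {s. (\<forall>j<r. 0 \<le> coord s j) \<and> (\<Sum>j<r. coord s j) \<le> 1 \<and>
       (\<forall>i. r \<le> Rep_idx i \<longrightarrow> s $ i \<in> {0..1})}"
    by (auto simp: cylinder_def space_PiM)
  \<comment> \<open>\<open>h\<close> is normal to the hyperplane on which the first \<open>r\<close>
    coordinates sum to 1.\<close>
  define h :: "real ^ 'n idx" where "h = (\<Sum>j<r. axis (Abs_idx j) 1)"
  have h: "h \<bullet> s = (\<Sum>j<r. coord s j)" for s
    by (simp add: h_def inner_sum_left inner_axis' coord_def)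
  define N where "N = (\<Union>j<r. {s :: real ^ 'n idx. axis (Abs_idx j) 1 \<bullet> s = 0}) \<union> {s. h \<bullet> s = 1}"
  have negN: "negligible N"
    unfolding N_def by (intro negligible_Un negligible_Union) (auto intro!: negligible_hyperplane simp: axis_eq_0_iff)
  have DC1: "D \<subseteq> ?C" unfolding Ceq D_def by (auto intro: less_imp_le)
  have DC2: "?C - D \<subseteq> N"
  proof
    fix s assume s: "s \<in> ?C - D"
    then consider j where "j < r" "coord s j = 0" | "(\<Sum>j<r. coord s j) = 1"
      unfolding Ceq D_def by force
    then show "s \<in> N" by cases (auto simp: N_def h inner_axis' coord_def)
  qed
  have sd: "negligible (?C - D \<union> (D - ?C))"
    using negligible_subset[OF negN DC2] DC1 by (simp add: Diff_eq_empty_iff[THEN iffD2])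
  have "D \<in> lmeasurable"
  proof -
    have "?C - D \<in> lmeasurable"
      using negligible_subset[OF negN DC2] by (simp add: negligible_imp_measurable)
    then have "?C - (?C - D) \<in> lmeasurable" by (rule fmeasurable.Diff[OF Cm])
    moreover have "?C - (?C - D) = D" using DC1 by blast
    ultimately show ?thesis by simp
  qed
  moreover have "measure lebesgue D = measure lebesgue ?C"
    using measure_negligible_symdiff[OF Cm sd] by simp
  ultimately show "D \<in> lmeasurable" "measure lebesgue D = 1 / fact r" using mC by auto
qed

lemma det_in_Ints:
  fixes A :: "real ^ 'n::finite ^ 'n"
  assumes "\<And>i j. A $ i $ j \<in> \<int>"
  shows "det A \<in> \<int>"
  unfolding det_def using assms by (intro Ints_sum Ints_mult Ints_prod) auto

text \<open>\<open>K\<close> is the affine image of the cylinder over the open unit simplex, written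
  in the orthonormal coordinates \<open>u\<close>. Its measure is
  \<open>\<bar>det M\<bar> / fact r\<close>, and the square of \<open>det M\<close> is a nonzero
  integer because it is a Gram determinant of lattice vectors.\<close>

lemma lattice_simplex_volume:
  fixes u :: "nat \<Rightarrow> real ^ 'n::finite"
  assumes r: "r \<le> CARD('n)"
    and u: "\<forall>i<r. \<forall>j<r. u i \<bullet> u j = (if i = j then 1 else 0)"
    and v: "\<And>j. j \<le> r \<Longrightarrow> v j \<in> range (vol_param r a u)"
    and int: "\<And>j i. j \<le> r \<Longrightarrow> v j $ i \<in> \<int>"
    and indep: "\<And>c j. (\<Sum>j<r. c j *\<^sub>R (v (Suc j) - v 0)) = 0 \<Longrightarrow> j < r \<Longrightarrow> c j = 0"
  shows "\<exists>K :: (real ^ 'n idx) set. K \<in> lmeasurable \<and> 1 / fact r \<le> measure lebesgue K \<and>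
    (\<forall>q\<in>K. (\<forall>i. r \<le> Rep_idx i \<longrightarrow> q $ i \<in> {0..1}) \<and>
       (\<exists>c. (\<forall>j\<le>r. 0 < c j) \<and> (\<Sum>j\<le>r. c j) = 1 \<and> vol_param r a u (coord q) = (\<Sum>j\<le>r. c j *\<^sub>R v j)))"
proof -
  let ?n = "CARD('n)"
  have inv: "Rep_idx (Abs_idx j :: 'n idx) = j" if "j < r" for j using that r by (simp add: Abs_idx_inverse)
  \<comment> \<open>By orthonormality the parameters of a point are its inner products with the
    \<open>u i\<close>.\<close>
  have exp_v: "v j = a + (\<Sum>i<r. ((v j - a) \<bullet> u i) *\<^sub>R u i)" if j: "j \<le> r" for j
  proof -
    obtain t where t: "v j = vol_param r a u t" using v[OF j] by blast
    have "(v j - a) \<bullet> u i = t i" if i: "i < r" for i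
    proof -
      have "(v j - a) \<bullet> u i = (\<Sum>k<r. t k * (u k \<bullet> u i))"
        by (simp add: t vol_param_def inner_sum_left)
      also have "\<dots> = (\<Sum>k<r. if k = i then t k else 0)"
        by (rule sum.cong) (use i u in auto)
      also have "\<dots> = t i" using i by simp
      finally show ?thesis .
    qed
    then show ?thesis using t by (simp add: vol_param_def)
  qed
  define w where "w j = v (Suc j) - v 0" for j
  have exp_w: "w j = (\<Sum>i<r. (w j \<bullet> u i) *\<^sub>R u i)" if "j < r" for j
  proof -
    have "w j = (\<Sum>i<r. ((v (Suc j) - a) \<bullet> u i) *\<^sub>R u i) - (\<Sum>i<r. ((v 0 - a) \<bullet> u i) *\<^sub>R u i)"
      using arg_cong2[where f = "(-)", OF exp_v[of "Suc j"] exp_v[of 0]] that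
      by (simp only: w_def add_diff_cancel_left)
    also have "\<dots> = (\<Sum>i<r. (w j \<bullet> u i) *\<^sub>R u i)"
      by (simp add: sum_subtractf[symmetric] scaleR_diff_left[symmetric] inner_diff_left[symmetric] w_def)
    finally show ?thesis .
  qed
  \<comment> \<open>Block matrix: the coordinates of the edges \<open>w k\<close> fill the leading
    block of size \<open>r\<close>, and an identity block leaves the unit intervals of the cylinder
    alone.\<close>
  define m where "m i k = (if k < r then (if i < r then w k \<bullet> u i else 0) else if i = k then 1 else 0)" for i k
  define M :: "real ^ 'n idx ^ 'n idx" where "M = (\<chi> i k. m (Rep_idx i) (Rep_idx k))"
  have gram: "(transpose M ** M) $ k $ l = (\<Sum>i<?n. m i (Rep_idx k) * m i (Rep_idx l))" for k l
    unfolding matrix_matrix_mult_def transpose_def M_def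
    by (simp add: sum_idx[of "\<lambda>i. m i (Rep_idx k) * m i (Rep_idx l)"])
  have split: "(\<Sum>i<?n. f i) = (\<Sum>i<r. f i) + (\<Sum>i=r..<?n. f i)" for f :: "nat \<Rightarrow> real"
    using r by (metis atLeast0LessThan le0 sum.atLeastLessThan_concat)
  \<comment> \<open>The Gram matrix is integral although the coordinates \<open>w k \<bullet> u i\<close> are not.\<close>
  have gram_int: "(\<Sum>i<?n. m i k * m i l) \<in> \<int>" if kl: "k < ?n" "l < ?n" for k l
  proof (cases "k < r \<and> l < r")
    case True
    have "(\<Sum>i<?n. m i k * m i l) = (\<Sum>i<r. (w k \<bullet> u i) * (w l \<bullet> u i))"
      unfolding split using True by (simp add: m_def)
    also have "\<dots> = w k \<bullet> (\<Sum>i<r. (w l \<bullet> u i) *\<^sub>R u i)" by (simp add: inner_sum_right mult.commute)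
    also have "\<dots> = w k \<bullet> w l" using exp_w[of l] True by simp
    also have "\<dots> \<in> \<int>"
      unfolding inner_vec_def w_def using int True by (intro Ints_sum) (auto intro!: Ints_mult Ints_diff)
    finally show ?thesis .
  next
    case False
    have "m i k * m i l \<in> \<int>" if "i < ?n" for i
      using False by (auto simp: m_def split: if_splits)
    then show ?thesis by (intro Ints_sum) auto
  qed
  have lt: "Rep_idx (i :: 'n idx) < ?n" for i using Rep_idx[of i] by simp
  have dsq: "(det M)\<^sup>2 \<in> \<int>"
  proof -
    have "det (transpose M ** M) \<in> \<int>" by (rule det_in_Ints) (simp add: gram gram_int lt)
    then show ?thesis by (simp add: det_mul power2_eq_square)
  qed
  have Mv: "(M *v s) $ i = (if Rep_idx i < r then (\<Sum>j<r. (w j \<bullet> u (Rep_idx i)) * coord s j) else s $ i)" for s i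
  proof -
    have "(M *v s) $ i = (\<Sum>k\<in>(UNIV :: 'n idx set). m (Rep_idx i) (Rep_idx k) * coord s (Rep_idx k))"
      by (simp add: M_def matrix_vector_mult_def coord_def Rep_idx_inverse)
    also have "\<dots> = (\<Sum>k<?n. m (Rep_idx i) k * coord s k)"
      by (rule sum_idx[of "\<lambda>k. m (Rep_idx i) k * coord s k"])
    also have "\<dots> = (\<Sum>k<r. m (Rep_idx i) k * coord s k) + (\<Sum>k=r..<?n. if k = Rep_idx i then coord s k else 0)"
      unfolding split by (intro arg_cong2[of _ _ _ _ "(+)"] refl sum.cong) (auto simp: m_def)
    also have "\<dots> = (if Rep_idx i < r then (\<Sum>j<r. (w j \<bullet> u (Rep_idx i)) * coord s j) else s $ i)"
      using lt[of i] by (auto simp: m_def coord_def Rep_idx_inverse)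
    finally show ?thesis .
  qed
  \<comment> \<open>A kernel vector vanishes from coordinate \<open>r\<close> on by the identity
    block; its first \<open>r\<close> coordinates give a linear relation among the edges, which is
    trivial by \<open>indep\<close>.\<close>
  have "det M \<noteq> 0"
  proof -
    have "s = 0" if s: "M *v s = 0" for s
    proof -
      have z: "(\<Sum>j<r. coord s j * (w j \<bullet> u i)) = 0" if i: "i < r" for i
        using Mv[of s "Abs_idx i"] i s by (simp add: inv mult.commute)
      have "(\<Sum>j<r. coord s j *\<^sub>R w j) = (\<Sum>j<r. coord s j *\<^sub>R (\<Sum>i<r. (w j \<bullet> u i) *\<^sub>R u i))"
        using exp_w by (intro sum.cong) auto
      also have "\<dots> = (\<Sum>i<r. (\<Sum>j<r. coord s j * (w j \<bullet> u i)) *\<^sub>R u i)"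
        by (simp add: scaleR_sum_right scaleR_sum_left) (rule sum.swap)
      also have "\<dots> = 0" using z by simp
      finally have "\<And>j. j < r \<Longrightarrow> coord s j = 0" using indep[of "coord s"] by (auto simp: w_def)
      moreover have "s $ i = coord s (Rep_idx i)" for i by (simp add: coord_def Rep_idx_inverse)
      moreover have "s $ i = 0" if "\<not> Rep_idx i < r" for i using Mv[of s i] s that by simp
      ultimately show ?thesis by (metis vec_eq_iff zero_index)
    qed
    then show ?thesis
      by (metis invertible_det_nz invertible_left_inverse matrix_left_invertible_ker)
  qed
  then have "1 \<le> (det M)\<^sup>2" using Ints_nonzero_abs_ge1[OF dsq] by simp
  then have det1: "1 \<le> \<bar>det M\<bar>" using one_le_power abs_le_square_iff[of 1 "det M"] by simp
  define D :: "(real ^ 'n idx) set" where "D = {s. (\<forall>j<r. 0 < coord s j) \<and> (\<Sum>j<r. coord s j) < 1 \<and>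
       (\<forall>i. r \<le> Rep_idx i \<longrightarrow> s $ i \<in> {0..1})}"
  have D: "D \<in> lmeasurable" "measure lebesgue D = 1 / fact r"
    unfolding D_def by (rule measure_unit_simplex_cylinder[OF r])+
  \<comment> \<open>The coordinates of the base vertex, padded by zeros so that the translation also
    preserves the unit intervals.\<close>
  define q0 :: "real ^ 'n idx" where "q0 = (\<chi> i. if Rep_idx i < r then (v 0 - a) \<bullet> u (Rep_idx i) else 0)"
  define K where "K = (+) q0 ` ((*v) M) ` D"
  have lin: "linear ((*v) M)" by simp
  have "K \<in> lmeasurable"
    unfolding K_def by (intro measurable_translation measurable_linear_image lin D)
  moreover have "1 / fact r \<le> measure lebesgue K"
  proof -
    have "measure lebesgue K = \<bar>det M\<bar> * (1 / fact r)"
      unfolding K_def measure_translation by (simp add: measure_linear_image[OF lin D(1)] D(2))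
    then show ?thesis using det1 by (simp add: divide_right_mono)
  qed
  moreover have "(\<forall>i. r \<le> Rep_idx i \<longrightarrow> q $ i \<in> {0..1}) \<and>
       (\<exists>c. (\<forall>j\<le>r. 0 < c j) \<and> (\<Sum>j\<le>r. c j) = 1 \<and> vol_param r a u (coord q) = (\<Sum>j\<le>r. c j *\<^sub>R v j))"
    if q: "q \<in> K" for q
  proof -
    obtain s where s: "s \<in> D" "q = q0 + M *v s" using q by (auto simp: K_def)
    have 1: "q $ i \<in> {0..1}" if "r \<le> Rep_idx i" for i
      using s that by (simp add: Mv q0_def D_def)
    \<comment> \<open>Barycentric coordinates: the base vertex receives what the \<open>r\<close>
      edge coefficients leave from 1.\<close>
    define c where "c j = (case j of 0 \<Rightarrow> 1 - (\<Sum>j<r. coord s j) | Suc k \<Rightarrow> coord s k)" for j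
    have pos: "0 < c j" if "j \<le> r" for j using s(1) that by (auto simp: c_def D_def split: nat.split)
    have sumc: "(\<Sum>j\<le>r. c j) = 1" by (simp add: sum.atMost_shift c_def)
    have cq: "coord q i = (v 0 - a) \<bullet> u i + (\<Sum>j<r. coord s j * (w j \<bullet> u i))" if "i < r" for i
      using that Mv[of s "Abs_idx i"] by (simp add: s(2) coord_def q0_def inv mult.commute)
    have "vol_param r a u (coord q) =
        a + (\<Sum>i<r. ((v 0 - a) \<bullet> u i) *\<^sub>R u i) + (\<Sum>i<r. (\<Sum>j<r. coord s j * (w j \<bullet> u i)) *\<^sub>R u i)"
      unfolding vol_param_def by (simp add: cq scaleR_add_left sum.distrib add.assoc)
    also have "a + (\<Sum>i<r. ((v 0 - a) \<bullet> u i) *\<^sub>R u i) = v 0" using exp_v[of 0] by simp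
    also have "(\<Sum>i<r. (\<Sum>j<r. coord s j * (w j \<bullet> u i)) *\<^sub>R u i) = (\<Sum>j<r. coord s j *\<^sub>R (\<Sum>i<r. (w j \<bullet> u i) *\<^sub>R u i))"
      by (simp add: scaleR_sum_right scaleR_sum_left) (rule sum.swap)
    also have "\<dots> = (\<Sum>j<r. coord s j *\<^sub>R w j)" using exp_w by (intro sum.cong) auto
    also have "v 0 + \<dots> = (\<Sum>j\<le>r. c j *\<^sub>R v j)"
      by (simp add: sum.atMost_shift c_def w_def scaleR_diff_right sum_subtractf scaleR_diff_left scaleR_sum_left)
    finally show ?thesis using 1 pos sumc by blast
  qed
  ultimately show ?thesis by blast
qed

section \<open>Affine dimension and the volume \<open>vol_r\<close>\<close>

text \<open>The last component of a relation among the vectors \<open>(x, 1)\<close> says that the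
  coefficients sum to zero, as an affine dependence requires.\<close>

lemma independent_homogenize_iff:
  fixes B :: "'a::euclidean_space set"
  assumes "finite B"
  shows "independent ((\<lambda>x. (x, 1::real)) ` B) \<longleftrightarrow> \<not> affine_dependent B"
proof -
  have inj: "inj_on (\<lambda>x. (x, 1::real)) B" by (auto simp: inj_on_def)
  have "dependent ((\<lambda>x. (x, 1::real)) ` B) \<longleftrightarrow>
      (\<exists>U. (\<exists>v\<in>B. U v \<noteq> 0) \<and> (\<Sum>v\<in>B. U v *\<^sub>R (v, 1::real)) = 0)" (is "_ \<longleftrightarrow> ?R")
  proof
    assume "dependent ((\<lambda>x. (x, 1::real)) ` B)"
    then obtain U where "\<exists>v\<in>(\<lambda>x. (x, 1::real)) ` B. U v \<noteq> 0" "(\<Sum>v\<in>(\<lambda>x. (x, 1::real)) ` B. U v *\<^sub>R v) = 0"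
      unfolding dependent_finite[OF finite_imageI[OF assms]] by blast
    then show ?R using inj by (intro exI[of _ "\<lambda>x. U (x, 1)"]) (auto simp: sum.reindex)
  next
    assume ?R
    then obtain U v where "v \<in> B" "U v \<noteq> 0" "(\<Sum>v\<in>B. U v *\<^sub>R (v, 1::real)) = 0" by blast
    then show "dependent ((\<lambda>x. (x, 1::real)) ` B)"
      using independent_family_zero[OF assms inj, of U v] by auto
  qed
  also have "\<dots> \<longleftrightarrow> affine_dependent B"
    unfolding affine_dependent_explicit_finite[OF assms]
    by (auto simp: prod_eq_iff fst_sum snd_sum)
  finally show ?thesis by blast
qed

text \<open>Bases pass both ways: independent homogenised points come from affinely independent
  points and conversely. An affinely independent set has one point more than its dimension.\<close>

lemma dim_homogenize:
  fixes S :: "'a::euclidean_space set"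
  assumes "finite S"
  shows "int (dim ((\<lambda>x. (x, 1::real)) ` S)) = aff_dim S + 1"
proof (rule antisym)
  let ?w = "\<lambda>x::'a. (x, 1::real)"
  obtain B where B: "B \<subseteq> ?w ` S" "independent B" "?w ` S \<subseteq> span B" "card B = dim (?w ` S)"
    by (rule basis_exists)
  obtain C where C: "C \<subseteq> S" "B = ?w ` C" using B(1) by (auto simp: subset_image_iff)
  have finC: "finite C" using C assms finite_subset by blast
  have "\<not> affine_dependent C" using independent_homogenize_iff[OF finC] B(2) C(2) by simp
  then have "aff_dim C = int (card C) - 1" using aff_dim_affine_independent[of C] by simp
  moreover have "card B = card C" unfolding C(2) by (rule card_image) (simp add: inj_on_def)
  ultimately show "int (dim (?w ` S)) \<le> aff_dim S + 1"
    using aff_dim_subset[OF C(1)] B(4) by simp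
  obtain b where b: "\<not> affine_dependent b" "b \<subseteq> S" "affine hull b = affine hull S"
    using affine_basis_exists[of S] by blast
  have finb: "finite b" using b assms finite_subset by blast
  have "independent (?w ` b)" using independent_homogenize_iff[OF finb] b by simp
  then have "card (?w ` b) \<le> dim (?w ` S)"
    using b(2) by (intro independent_card_le_dim) auto
  moreover have "card (?w ` b) = card b" by (rule card_image) (simp add: inj_on_def)
  moreover have "aff_dim S = int (card b) - 1"
    using aff_dim_affine_independent[OF b(1)] b(3) aff_dim_affine_hull[of b] aff_dim_affine_hull[of S] by simp
  ultimately show "aff_dim S + 1 \<le> int (dim (?w ` S))" by simp
qed

text \<open>The choice inside \<open>vol_r\<close> is meaningful only if some parametrisation
  exists; an orthonormal basis of the direction space \<open>L\<close> of the affine hull supplies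
  one.\<close>

lemma vol_r_orthonormal_param:
  fixes S :: "'a::euclidean_space set"
  assumes "aff_dim S = int r"
  obtains a u where "\<forall>i<r. \<forall>j<r. u i \<bullet> u j = (if i = j then 1 else 0)"
    "affine hull S = vol_param r a u ` (PiE {..<r} (\<lambda>_. UNIV))"
    "vol_r r S = measure (PiM {..<r} (\<lambda>_. lborel)) {t \<in> PiE {..<r} (\<lambda>_. UNIV). vol_param r a u t \<in> S}"
proof -
  let ?Q = "\<lambda>(a, u). (\<forall>i<r. \<forall>j<r. u i \<bullet> u j = (if i = j then 1 else 0))
      \<and> affine hull S = vol_param r a u ` (PiE {..<r} (\<lambda>_. UNIV))"
  have "S \<noteq> {}" using assms by force
  then obtain a where a: "a \<in> affine hull S" by (metis all_not_in_conv hull_inc)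
  define L where "L = (+) (- a) ` (affine hull S)"
  have L: "subspace L" unfolding L_def using affine_diffs_subspace[OF affine_affine_hull a] .
  have dimL: "dim L = r"
  proof -
    have "aff_dim (affine hull S) = int (dim L)"
      unfolding L_def by (rule aff_dim_eq_dim) (use a in \<open>simp add: hull_hull\<close>)
    then show ?thesis using assms by simp
  qed
  obtain B where B: "B \<subseteq> L" "pairwise orthogonal B" "\<And>x. x \<in> B \<Longrightarrow> norm x = 1"
    "independent B" "card B = dim L" "span B = L"
    using orthonormal_basis_subspace[OF L] by blast
  have finB: "finite B" using B(4) by (rule independent_imp_finite)
  obtain u where u: "bij_betw u {..<r} B"
    using ex_bij_betw_nat_finite[OF finB] B(5) dimL by (auto simp: atLeast0LessThan)
  have uB: "u i \<in> B" if "i < r" for i using bij_betwE[OF u] that by auto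
  have orth: "u i \<bullet> u j = (if i = j then 1 else 0)" if "i < r" "j < r" for i j
  proof (cases "i = j")
    case True then show ?thesis using B(3)[OF uB[OF that(1)]] by (simp add: dot_square_norm)
  next
    case False
    then have "u i \<noteq> u j" using u that by (metis bij_betw_imp_inj_on inj_onD lessThan_iff)
    then show ?thesis using B(2) uB that False by (auto simp: pairwise_def orthogonal_def)
  qed
  have "affine hull S = vol_param r a u ` (PiE {..<r} (\<lambda>_. UNIV))"
  proof (intro set_eqI iffI)
    fix x assume "x \<in> affine hull S"
    then have "- a + x \<in> span (u ` {..<r})" using B(6) u by (auto simp: L_def bij_betw_def)
    then obtain c where c: "- a + x = (\<Sum>j<r. c j *\<^sub>R u j)"
      using span_image_finite_sum[of "{..<r}" u] u by (auto simp: bij_betw_def)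
    have "x = vol_param r a u (restrict c {..<r})"
      using c by (simp add: vol_param_def algebra_simps)
    then show "x \<in> vol_param r a u ` (PiE {..<r} (\<lambda>_. UNIV))" by auto
  next
    fix x assume "x \<in> vol_param r a u ` (PiE {..<r} (\<lambda>_. UNIV))"
    then obtain t where t: "x = a + (\<Sum>j<r. t j *\<^sub>R u j)" by (auto simp: vol_param_def)
    have "(\<Sum>j<r. t j *\<^sub>R u j) \<in> L"
      using L uB B(1) by (intro subspace_sum subspace_scale) auto
    then show "x \<in> affine hull S" unfolding t L_def by auto
  qed
  then have "?Q (a, u)" using orth by auto
  then have Q: "?Q (SOME z. ?Q z)" by (rule someI)
  obtain a' u' where z: "(SOME z. ?Q z) = (a', u')" by (cases "SOME z. ?Q z")
  show thesis
  proof (rule that)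
    show "vol_r r S = measure (PiM {..<r} (\<lambda>_. lborel)) {t \<in> PiE {..<r} (\<lambda>_. UNIV). vol_param r a' u' t \<in> S}"
      unfolding vol_r_def z by simp
  qed (use Q z in auto)
qed

lemma vol_param_restrict: "vol_param r a u (restrict t {..<r}) = vol_param r a u t"
  by (simp add: vol_param_def)

section \<open>Packing lattice simplices into the polytope\<close>

text \<open>Each simplex yields a set \<open>K\<close> of measure at least \<open>1 / fact r\<close>
  inside the cylinder \<open>Z\<close> over the polytope. These sets are pairwise disjoint, and
  \<open>Z\<close> has measure \<open>vol_r r\<close> of the polytope.\<close>

lemma card_triangulation_le_volume:
  fixes G :: "((real ^ 'n::finite) \<times> real) set"
  assumes G: "finite G" and int: "\<And>g i. g \<in> G \<Longrightarrow> fst g $ i \<in> \<int>"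
    and r: "aff_dim (convex hull (fst ` G)) = int r"
    and vol: "0 < vol_r r (convex hull (fst ` G))"
  defines "w \<equiv> \<lambda>g :: (real ^ 'n) \<times> real. (fst g, 1::real)"
  assumes T: "finite T" "\<And>\<tau>. \<tau> \<in> T \<Longrightarrow> \<tau> \<subseteq> G" "\<And>\<tau>. \<tau> \<in> T \<Longrightarrow> inj_on w \<tau>"
      "\<And>\<tau>. \<tau> \<in> T \<Longrightarrow> independent (w ` \<tau>)" "\<And>\<tau>. \<tau> \<in> T \<Longrightarrow> card \<tau> = Suc r"
    and disj: "\<And>\<tau> \<tau>' c c'. \<lbrakk>\<tau> \<in> T; \<tau>' \<in> T; \<And>g. g \<in> \<tau> \<Longrightarrow> 0 < c g; \<And>g. g \<in> \<tau>' \<Longrightarrow> 0 < c' g;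
       (\<Sum>g\<in>\<tau>. c g *\<^sub>R w g) = (\<Sum>g\<in>\<tau>'. c' g *\<^sub>R w g)\<rbrakk> \<Longrightarrow> \<tau> = \<tau>'"
  shows "real (card T) \<le> fact r * vol_r r (convex hull (fst ` G))"
proof -
  let ?P = "convex hull (fst ` G)" and ?M = "PiM {..<r} (\<lambda>_. lborel :: real measure)"
  obtain a u where u: "\<forall>i<r. \<forall>j<r. u i \<bullet> u j = (if i = j then 1 else 0)"
    and aff: "affine hull ?P = vol_param r a u ` (PiE {..<r} (\<lambda>_. UNIV))"
    and v: "vol_r r ?P = measure ?M {t \<in> PiE {..<r} (\<lambda>_. UNIV). vol_param r a u t \<in> ?P}"
    by (rule vol_r_orthonormal_param[OF r])
  define B where "B = {t \<in> PiE {..<r} (\<lambda>_. UNIV). vol_param r a u t \<in> ?P}"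
  have rn: "r \<le> CARD('n)" using aff_dim_le_DIM[of ?P] r by simp
  have Bm: "B \<in> sets ?M"
  proof -
    have "vol_param r a u \<in> borel_measurable ?M"
      unfolding vol_param_def[abs_def] by measurable
    moreover have "?P \<in> sets borel"
      using G by (intro borel_closed compact_imp_closed finite_imp_compact_convex_hull) auto
    ultimately have "vol_param r a u -` ?P \<inter> space ?M \<in> sets ?M" by (rule measurable_sets)
    also have "vol_param r a u -` ?P \<inter> space ?M = B" by (auto simp: B_def space_PiM)
    finally show ?thesis .
  qed
  define Z :: "(real ^ 'n idx) set" where "Z = cylinder r B"
  have emZ: "emeasure lborel Z = emeasure ?M B" unfolding Z_def by (rule emeasure_cylinder[OF rn Bm])
  have Zb: "Z \<in> sets borel" unfolding Z_def by (rule cylinder_borel[OF Bm])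
  have mZ: "measure lebesgue Z = vol_r r ?P"
    using emZ Zb v by (simp add: measure_completion measure_def B_def)
  \<comment> \<open>\<open>measure\<close> is 0 on sets of infinite measure, so positive volume
    forces \<open>Z\<close> to have finite measure.\<close>
  have Zm: "Z \<in> lmeasurable"
    using mZ vol Zb by (intro fmeasurableI) (auto simp: measure_def less_top[symmetric])
  let ?K = "\<lambda>\<tau> K. K \<in> lmeasurable \<and> 1 / fact r \<le> measure lebesgue K \<and>
    (\<forall>q\<in>K. (\<forall>i :: 'n idx. r \<le> Rep_idx i \<longrightarrow> q $ i \<in> {0..1}) \<and>
       (\<exists>c. (\<forall>g\<in>\<tau>. 0 < c g) \<and> (\<Sum>g\<in>\<tau>. c g) = 1 \<and> vol_param r a u (coord q) = (\<Sum>g\<in>\<tau>. c g *\<^sub>R fst g)))"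
  have "\<exists>K. ?K \<tau> K" if \<tau>: "\<tau> \<in> T" for \<tau>
  proof -
    have fin: "finite \<tau>" using T(2)[OF \<tau>] G finite_subset by blast
    obtain e where e: "bij_betw e {..r} \<tau>"
      using ex_bij_betw_nat_finite[OF fin] T(5)[OF \<tau>] by (auto simp: atLeast0LessThan lessThan_Suc_atMost)
    have eG: "e j \<in> G" if "j \<le> r" for j using bij_betwE[OF e] T(2)[OF \<tau>] that by auto
    let ?v = "\<lambda>j. fst (e j)"
    have "?v j \<in> affine hull ?P" if "j \<le> r" for j
      using eG[OF that] by (simp add: hull_inc)
    then have v1: "?v j \<in> range (vol_param r a u)" if "j \<le> r" for j
      using that unfolding aff by blast
    have v2: "?v j $ i \<in> \<int>" if "j \<le> r" for j i using int eG that by simp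
    have v3: "c j = 0" if c: "(\<Sum>j<r. c j *\<^sub>R (?v (Suc j) - ?v 0)) = 0" and j: "j < r" for c j
    proof -
      \<comment> \<open>The weight of the base vertex makes the weights sum to zero, so a relation
        among edges becomes one among homogenised vertices.\<close>
      define d where "d j = (case j of 0 \<Rightarrow> - (\<Sum>j<r. c j) | Suc k \<Rightarrow> c k)" for j
      have "(\<Sum>j\<le>r. d j *\<^sub>R w (e j)) = ((\<Sum>j<r. c j *\<^sub>R (?v (Suc j) - ?v 0)), 0)"
        by (simp add: sum.atMost_shift d_def w_def prod_eq_iff fst_sum snd_sum scaleR_diff_right
            sum_subtractf scaleR_sum_left)
      then have "(\<Sum>j\<le>r. d j *\<^sub>R w (e j)) = 0" using c by (simp add: zero_prod_def)
      moreover have "inj_on (\<lambda>j. w (e j)) {..r}"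
        using comp_inj_on[of e "{..r}" w] e T(3)[OF \<tau>] by (simp add: bij_betw_def o_def)
      moreover have "(\<lambda>j. w (e j)) ` {..r} = w ` \<tau>"
        using e by (auto simp: bij_betw_def)
      ultimately have "d (Suc j) = 0"
        using independent_family_zero[of "{..r}" "\<lambda>j. w (e j)" d "Suc j"] T(4)[OF \<tau>] j by simp
      then show ?thesis by (simp add: d_def)
    qed
    have "\<exists>K :: (real ^ 'n idx) set. K \<in> lmeasurable \<and> 1 / fact r \<le> measure lebesgue K \<and>
      (\<forall>q\<in>K. (\<forall>i. r \<le> Rep_idx i \<longrightarrow> q $ i \<in> {0..1}) \<and>
       (\<exists>c. (\<forall>j\<le>r. 0 < c j) \<and> (\<Sum>j\<le>r. c j) = 1 \<and> vol_param r a u (coord q) = (\<Sum>j\<le>r. c j *\<^sub>R ?v j)))"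
      by (rule lattice_simplex_volume[OF rn u]) (erule v1, erule v2, rule v3, assumption, assumption)
    then obtain K :: "(real ^ 'n idx) set" where K: "K \<in> lmeasurable" "1 / fact r \<le> measure lebesgue K"
      "\<And>q. q \<in> K \<Longrightarrow> (\<forall>i. r \<le> Rep_idx i \<longrightarrow> q $ i \<in> {0..1}) \<and>
       (\<exists>c. (\<forall>j\<le>r. 0 < c j) \<and> (\<Sum>j\<le>r. c j) = 1 \<and> vol_param r a u (coord q) = (\<Sum>j\<le>r. c j *\<^sub>R ?v j))"
      by blast
    have comb: "\<exists>c. (\<forall>g\<in>\<tau>. 0 < c g) \<and> (\<Sum>g\<in>\<tau>. c g) = 1 \<and> vol_param r a u (coord q) = (\<Sum>g\<in>\<tau>. c g *\<^sub>R fst g)"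
      if q: "q \<in> K" for q
    proof -
      obtain c where c: "\<forall>j\<le>r. 0 < c j" "(\<Sum>j\<le>r. c j) = 1" "vol_param r a u (coord q) = (\<Sum>j\<le>r. c j *\<^sub>R ?v j)"
        using K(3)[OF q] by blast
      define c' where "c' g = c (the_inv_into {..r} e g)" for g
      have c'e: "c' (e j) = c j" if "j \<le> r" for j
        using e that by (simp add: c'_def bij_betw_def the_inv_into_f_f)
      have "(\<Sum>g\<in>\<tau>. c' g) = (\<Sum>j\<le>r. c j)"
        using sum.reindex_bij_betw[OF e, of c'] by (simp add: c'e)
      moreover have "(\<Sum>g\<in>\<tau>. c' g *\<^sub>R fst g) = (\<Sum>j\<le>r. c j *\<^sub>R ?v j)"
        using sum.reindex_bij_betw[OF e, of "\<lambda>g. c' g *\<^sub>R fst g"] by (simp add: c'e)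
      moreover have "\<forall>g\<in>\<tau>. 0 < c' g" using e c(1) c'e by (force simp: bij_betw_def)
      ultimately show ?thesis using c by (intro exI[of _ c']) simp
    qed
    show ?thesis
      by (intro exI[of _ K] conjI ballI K(1,2) K(3)[THEN conjunct1] comb)
  qed
  then have "\<forall>\<tau>\<in>T. \<exists>K. ?K \<tau> K" by simp
  then have "\<exists>K. \<forall>\<tau>\<in>T. ?K \<tau> (K \<tau>)" by (rule bchoice)
  then obtain K where K0: "\<forall>\<tau>\<in>T. ?K \<tau> (K \<tau>)" ..
  note K = bspec[OF K0]
  have KZ: "K \<tau> \<subseteq> Z" if \<tau>: "\<tau> \<in> T" for \<tau>
  proof
    fix q assume q: "q \<in> K \<tau>"
    obtain c where c: "\<forall>g\<in>\<tau>. 0 < c g" "(\<Sum>g\<in>\<tau>. c g) = 1" "vol_param r a u (coord q) = (\<Sum>g\<in>\<tau>. c g *\<^sub>R fst g)"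
      using K[OF \<tau>] q by blast
    have "(\<Sum>g\<in>\<tau>. c g *\<^sub>R fst g) \<in> ?P"
      using c T(2)[OF \<tau>] G by (intro convex_sum) (auto intro: finite_subset hull_inc less_imp_le)
    then have "restrict (coord q) {..<r} \<in> B"
      using c(3) by (simp add: B_def vol_param_restrict)
    then show "q \<in> Z" using K[OF \<tau>] q by (simp add: Z_def cylinder_def)
  qed
  \<comment> \<open>A common point is a positive convex combination over both simplices. With the
    weights summing to 1, the two combinations also agree after homogenisation, and
    \<open>disj\<close> applies.\<close>
  have dK: "disjoint_family_on K T"
    unfolding disjoint_family_on_def
  proof (intro ballI impI, rule ccontr)
    fix \<tau> \<tau>' assume \<tau>: "\<tau> \<in> T" "\<tau>' \<in> T" "\<tau> \<noteq> \<tau>'" and "K \<tau> \<inter> K \<tau>' \<noteq> {}"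
    then obtain q where q: "q \<in> K \<tau>" "q \<in> K \<tau>'" by auto
    obtain c where c: "\<forall>g\<in>\<tau>. 0 < c g" "(\<Sum>g\<in>\<tau>. c g) = 1" "vol_param r a u (coord q) = (\<Sum>g\<in>\<tau>. c g *\<^sub>R fst g)"
      using K[OF \<tau>(1)] q(1) by blast
    obtain c' where c': "\<forall>g\<in>\<tau>'. 0 < c' g" "(\<Sum>g\<in>\<tau>'. c' g) = 1" "vol_param r a u (coord q) = (\<Sum>g\<in>\<tau>'. c' g *\<^sub>R fst g)"
      using K[OF \<tau>(2)] q(2) by blast
    have "(\<Sum>g\<in>\<tau>. c g *\<^sub>R w g) = (\<Sum>g\<in>\<tau>'. c' g *\<^sub>R w g)"
      using c(2,3) c'(2,3) by (simp add: prod_eq_iff fst_sum snd_sum w_def)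
    then show False using disj[OF \<tau>(1,2)] c(1) c'(1) \<tau>(3) by blast
  qed
  have Km: "K \<tau> \<in> lmeasurable" "1 / fact r \<le> measure lebesgue (K \<tau>)" if "\<tau> \<in> T" for \<tau>
    using K[OF that] by blast+
  have "real (card T) * (1 / fact r) \<le> (\<Sum>\<tau>\<in>T. measure lebesgue (K \<tau>))"
    using sum_bounded_below[of T "1 / fact r" "\<lambda>\<tau>. measure lebesgue (K \<tau>)"] Km(2) by simp
  also have "\<dots> = measure lebesgue (\<Union>\<tau>\<in>T. K \<tau>)"
  proof (rule measure_finite_Union[symmetric])
    show "K ` T \<subseteq> sets lebesgue" using Km(1) by (auto dest: fmeasurableD)
    show "emeasure lebesgue (K \<tau>) \<noteq> \<infinity>" if "\<tau> \<in> T" for \<tau>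
      using fmeasurableD2[OF Km(1)[OF that]] by simp
  qed (use T(1) dK in auto)
  also have "\<dots> \<le> measure lebesgue Z"
    using KZ T(1) Km(1) Zm by (intro measure_mono_fmeasurable) (auto intro!: sets.finite_UN)
  finally show ?thesis using mZ by (simp add: field_simps)
qed

section \<open>Tropical prevarieties\<close>

text \<open>Exponent and constant term form one vector, so that the tropical product of monomials
  becomes vector addition.\<close>

definition lift_monomial :: "'n::finite trop_monomial \<Rightarrow> (real ^ 'n) \<times> real" where
  "lift_monomial m = (\<chi> i. real (fst m i), snd m)"

definition lift_height :: "'a::real_inner \<Rightarrow> 'a \<times> real \<Rightarrow> real" where
  "lift_height x g = x \<bullet> fst g + snd g"

definition lowest :: "('a::real_inner \<times> real) set \<Rightarrow> 'a \<Rightarrow> ('a \<times> real) set" where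
  "lowest A x = {g\<in>A. \<forall>g'\<in>A. lift_height x g \<le> lift_height x g'}"

lemma lift_height_add: "lift_height x (g + h) = lift_height x g + lift_height x h"
  by (simp add: lift_height_def inner_add_right)

lemma lowest_nonempty: "finite A \<Longrightarrow> A \<noteq> {} \<Longrightarrow> lowest A x \<noteq> {}"
  using ex_is_arg_min_if_finite[of A "lift_height x"] unfolding lowest_def is_arg_min_linorder by blast

lemma inj_lift_monomial: "inj lift_monomial"
  by (auto simp: inj_def lift_monomial_def vec_eq_iff fun_eq_iff prod_eq_iff)

lemma lift_attaining: "lift_monomial ` attaining f x = lowest (lift_monomial ` f) x"
proof -
  have "mono_eval m x = lift_height x (lift_monomial m)" for m
    by (simp add: mono_eval_def lift_height_def lift_monomial_def inner_vec_def mult.commute)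
  then show ?thesis by (auto simp: attaining_def lowest_def)
qed

text \<open>A sum is lowest exactly when both summands are. Since the other factor has a lowest
  element too, every lowest \<open>a\<close> or \<open>b\<close> occurs in such a sum.\<close>

lemma lowest_sum_subset:
  assumes "finite A" "A \<noteq> {}" "finite B" "B \<noteq> {}"
    and eq: "lowest {a + b | a b. a \<in> A \<and> b \<in> B} x \<subseteq> lowest {a + b | a b. a \<in> A \<and> b \<in> B} y"
  shows "lowest A x \<subseteq> lowest A y" "lowest B x \<subseteq> lowest B y"
proof -
  have *: "a \<in> lowest A y \<and> b \<in> lowest B y" if ab: "a \<in> lowest A x" "b \<in> lowest B x" for a b
  proof -
    have "lift_height x (a + b) \<le> lift_height x (a' + b')" if "a' \<in> A" "b' \<in> B" for a' b'
      using ab that by (simp add: lowest_def lift_height_add add_mono)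
    then have "a + b \<in> lowest {a + b | a b. a \<in> A \<and> b \<in> B} x"
      using ab unfolding lowest_def by blast
    then have low: "a + b \<in> lowest {a + b | a b. a \<in> A \<and> b \<in> B} y" using eq by blast
    have ab': "a \<in> A" "b \<in> B" using ab by (auto simp: lowest_def)
    have "lift_height y (a + b) \<le> lift_height y (a' + b')" if "a' \<in> A" "b' \<in> B" for a' b'
      using low that unfolding lowest_def by blast
    from this[OF _ ab'(2)] this[OF ab'(1)]
    show ?thesis using ab' by (simp add: lowest_def lift_height_add)
  qed
  show "lowest A x \<subseteq> lowest A y" "lowest B x \<subseteq> lowest B y"
    using * lowest_nonempty[OF assms(1,2), of x] lowest_nonempty[OF assms(3,4), of x] by blast+
qed

lemma minkowski_sum_Cons:
  "minkowski_sum (A # As) = {a + b | a b. a \<in> A \<and> b \<in> minkowski_sum As}"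
  by (simp add: minkowski_sum_def)

lemma minkowski_sum_finite_nonempty:
  assumes "\<forall>A\<in>set As. finite A \<and> A \<noteq> {}"
  shows "finite (minkowski_sum As) \<and> minkowski_sum As \<noteq> {}"
  using assms
proof (induction As)
  case Nil then show ?case by (simp add: minkowski_sum_def)
next
  case (Cons A As)
  have "{a + b | a b. a \<in> A \<and> b \<in> minkowski_sum As} = (\<lambda>(a, b). a + b) ` (A \<times> minkowski_sum As)"
    by auto
  then show ?case using Cons unfolding minkowski_sum_Cons by auto
qed

lemma lowest_minkowski_sum_subset:
  assumes "\<forall>A\<in>set As. finite A \<and> A \<noteq> {}"
    and "lowest (minkowski_sum As) x \<subseteq> lowest (minkowski_sum As) y" and "A \<in> set As"
  shows "lowest A x \<subseteq> lowest A y"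
  using assms
proof (induction As)
  case (Cons B As)
  have fin: "finite B" "B \<noteq> {}" "finite (minkowski_sum As)" "minkowski_sum As \<noteq> {}"
    using Cons.prems(1) minkowski_sum_finite_nonempty[of As] by auto
  note sub = lowest_sum_subset[OF fin Cons.prems(2)[unfolded minkowski_sum_Cons]]
  show ?case using sub Cons by auto
qed simp

lemma convex_hull_minkowski_sum:
  fixes As :: "('a::real_vector \<times> 'b::real_vector) set list"
  shows "convex hull (fst ` minkowski_sum As) = minkowski_sum (map (\<lambda>A. convex hull (fst ` A)) As)"
proof (induction As)
  case Nil then show ?case by (simp add: minkowski_sum_def)
next
  case (Cons A As)
  have "fst ` {a + b | a b. a \<in> A \<and> b \<in> minkowski_sum As} = fst ` A + fst ` minkowski_sum As"
    by (force simp: set_plus_def image_iff)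
  then show ?case
    using Cons by (simp add: minkowski_sum_Cons convex_hull_set_plus) (auto simp: set_plus_def)
qed

lemma minkowski_sum_Ints:
  fixes As :: "((real ^ 'n::finite) \<times> real) set list"
  assumes "\<forall>A\<in>set As. \<forall>g\<in>A. fst g $ i \<in> \<int>" and "g \<in> minkowski_sum As"
  shows "fst g $ i \<in> \<int>"
  using assms
proof (induction As arbitrary: g)
  case Nil then show ?case by (simp add: minkowski_sum_def)
next
  case (Cons A As)
  then obtain a b where "g = a + b" "a \<in> A" "b \<in> minkowski_sum As"
    by (auto simp: minkowski_sum_Cons)
  then show ?case using Cons by auto
qed

section \<open>The bound for one tropical polynomial and for the prevariety\<close>

text \<open>Every point \<open>x\<close> gives a feasible vector \<open>(- x, \<mu>)\<close>, with
  \<mu> the minimal height at \<open>x\<close>, whose tight set is \<open>lowest G x\<close>. The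
  count of cells and the packing bound then combine.\<close>

lemma card_lowest_le_volume:
  fixes G :: "((real ^ 'n::finite) \<times> real) set"
  assumes G: "finite G" "G \<noteq> {}" and int: "\<And>g i. g \<in> G \<Longrightarrow> fst g $ i \<in> \<int>"
    and r: "aff_dim (convex hull (fst ` G)) = int r"
    and vol: "0 < vol_r r (convex hull (fst ` G))"
  shows "finite (range (lowest G))"
    "real (card (range (lowest G))) \<le> (2 ^ (r + 1) - 1) * fact r * vol_r r (convex hull (fst ` G))"
proof -
  define w where "w g = (fst g, 1::real)" for g :: "(real ^ 'n) \<times> real"
  let ?cells = "tight_set G w snd ` {y. feasible G w snd y} - {{}}"
  have in_cells: "lowest G x \<in> ?cells" for x
  proof -
    obtain g where g: "g \<in> lowest G x" using lowest_nonempty[OF G] by blast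
    have ev: "(- x, lift_height x g) \<bullet> w h = snd h + (lift_height x g - lift_height x h)" for h
      by (simp add: w_def lift_height_def inner_prod_def)
    have low: "g \<in> G" "\<And>h. h \<in> G \<Longrightarrow> lift_height x g \<le> lift_height x h"
      using g by (simp_all add: lowest_def)
    have "lift_height x g = lift_height x h \<longleftrightarrow> (\<forall>h'\<in>G. lift_height x h \<le> lift_height x h')" if "h \<in> G" for h
      using low(1) low(2)[OF that] low(2) by (metis order_antisym)
    then have "tight_set G w snd (- x, lift_height x g) = lowest G x"
      by (simp add: tight_set_def ev lowest_def cong: conj_cong)
    moreover have "feasible G w snd (- x, lift_height x g)"
      using low by (simp add: feasible_def ev)
    ultimately show ?thesis using g by blast
  qed
  then have sub: "range (lowest G) \<subseteq> ?cells" by blast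
  have finc: "finite ?cells"
    by (rule finite_subset[of _ "Pow G"]) (use G in \<open>auto simp: tight_set_def\<close>)
  show "finite (range (lowest G))" using finite_subset[OF sub finc] .
  obtain y0 where y0: "feasible G w snd y0" using in_cells by blast
  show "real (card (range (lowest G))) \<le> (2 ^ (r + 1) - 1) * fact r * vol_r r (convex hull (fst ` G))"
  proof (rule regular_cone_triangulation[OF G(1) y0])
    fix T assume T: "finite T" and bas: "\<And>\<tau>. \<tau> \<in> T \<Longrightarrow> basis_family G w \<tau>"
      and tight: "\<And>\<tau>. \<tau> \<in> T \<Longrightarrow> \<exists>y. feasible G w snd y \<and> \<tau> \<subseteq> tight_set G w snd y"
      and disj: "\<And>\<tau> \<tau>' c c'. \<lbrakk>\<tau> \<in> T; \<tau>' \<in> T; \<And>g. g \<in> \<tau> \<Longrightarrow> 0 < c g; \<And>g. g \<in> \<tau>' \<Longrightarrow> 0 < c' g;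
         (\<Sum>g\<in>\<tau>. c g *\<^sub>R w g) = (\<Sum>g\<in>\<tau>'. c' g *\<^sub>R w g)\<rbrakk> \<Longrightarrow> \<tau> = \<tau>'"
      and cover: "\<And>c. (\<And>g. g \<in> G \<Longrightarrow> 0 \<le> c g) \<Longrightarrow>
         \<exists>\<tau>\<in>T. \<exists>c'. (\<forall>g\<in>\<tau>. 0 \<le> c' g) \<and> (\<Sum>g\<in>G. c g *\<^sub>R w g) = (\<Sum>g\<in>\<tau>. c' g *\<^sub>R w g)"
    have "w ` G = (\<lambda>x. (x, 1::real)) ` (fst ` G)" by (auto simp: w_def image_iff)
    \<comment> \<open>Homogenising raises the dimension by one, so maximal simplices have
      \<open>Suc r\<close> vertices.\<close>
    then have dimG: "dim (w ` G) = Suc r"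
      using dim_homogenize[of "fst ` G"] G(1) r by (simp add: aff_dim_convex_hull)
    have sub\<tau>: "\<tau> \<subseteq> G" and inj\<tau>: "inj_on w \<tau>" and ind\<tau>: "independent (w ` \<tau>)" if "\<tau> \<in> T" for \<tau>
      using bas[OF that] by (auto simp: basis_family_def)
    have card\<tau>: "card \<tau> = Suc r" if "\<tau> \<in> T" for \<tau>
    proof -
      have "card \<tau> = card (w ` \<tau>)" using inj\<tau>[OF that] by (simp add: card_image)
      also have "\<dots> = dim (w ` \<tau>)" using ind\<tau>[OF that] by (simp add: dim_eq_card_independent)
      also have "\<dots> = dim (w ` G)" using bas[OF that] by (metis basis_family_def dim_span)
      finally show ?thesis using dimG by simp
    qed
    \<comment> \<open>The functional reading off the homogenising coordinate, which is always
      1.\<close>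
    have e: "0 < (0, 1) \<bullet> w g" for g by (simp add: w_def)
    have "card (range (lowest G)) \<le> card ?cells" by (rule card_mono[OF finc sub])
    also have "\<dots> \<le> card T * (2 ^ Suc r - 1)"
      by (rule card_cells_le[OF G(1) T card\<tau> sub\<tau> tight cover e])
    finally have "real (card (range (lowest G))) \<le> real (card T * (2 ^ Suc r - 1))"
      by (rule of_nat_mono)
    also have "\<dots> = (2 ^ (r + 1) - 1) * real (card T)" by (simp add: of_nat_diff)
    also have "\<dots> \<le> (2 ^ (r + 1) - 1) * (fact r * vol_r r (convex hull (fst ` G)))"
    proof (rule mult_left_mono)
      show "real (card T) \<le> fact r * vol_r r (convex hull (fst ` G))"
        by (rule card_triangulation_le_volume[OF G(1) int r vol T, folded w_def])
          (use sub\<tau> inj\<tau> ind\<tau> card\<tau> disj in blast)+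
    qed (use one_le_power[of "2::real" "r + 1"] in simp)
    finally show "real (card (range (lowest G))) \<le> (2 ^ (r + 1) - 1) * fact r * vol_r r (convex hull (fst ` G))"
      by (simp add: mult.assoc)
  qed
qed

text \<open>Picking a preimage under \<open>g\<close> expresses \<open>f\<close> on \<open>A\<close>
  as a function of the value of \<open>g\<close>.\<close>

lemma card_image_le_card_image_if_factors:
  assumes "finite (g ` A)" "\<And>x y. \<lbrakk>x \<in> A; y \<in> A; g x = g y\<rbrakk> \<Longrightarrow> f x = f y"
  shows "finite (f ` A)" "card (f ` A) \<le> card (g ` A)"
proof -
  have "f ` A = (\<lambda>s. f (inv_into A g s)) ` (g ` A)"
    unfolding image_image
    by (rule image_cong[OF refl], rule assms(2)) (auto simp: inv_into_into f_inv_into_f)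
  then show "finite (f ` A)" "card (f ` A) \<le> card (g ` A)"
    using assms(1) by (simp_all add: card_image_le)
qed

theorem theorem2p1:
  fixes fs :: "('n::finite) trop_poly list" and r :: nat
  assumes "\<forall>f\<in>set fs. is_trop_poly f"
    and "aff_dim (minkowski_sum (map newton_polytope fs)) = int r"
    and "vol_r r (minkowski_sum (map newton_polytope fs)) > 0"
  shows "real (card (prevariety_faces fs))
           \<le> (2 ^ (r + 1) - 1) * fact r * vol_r r (minkowski_sum (map newton_polytope fs))"
proof -
  let ?As = "map ((`) lift_monomial) fs"
  define G where "G = minkowski_sum ?As"
  have As: "\<forall>A\<in>set ?As. finite A \<and> A \<noteq> {}" using assms(1) by (auto simp: is_trop_poly_def)
  have G: "finite G" "G \<noteq> {}" using minkowski_sum_finite_nonempty[OF As] by (auto simp: G_def)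
  have newton: "newton_polytope f = convex hull (fst ` lift_monomial ` f)" for f :: "'n trop_poly"
    unfolding newton_polytope_def image_image by (simp add: lift_monomial_def)
  have P: "convex hull (fst ` G) = minkowski_sum (map newton_polytope fs)"
    unfolding G_def convex_hull_minkowski_sum by (simp add: newton[abs_def] o_def)
  have int: "fst g $ i \<in> \<int>" if "g \<in> G" for g i
    using that unfolding G_def by (rule minkowski_sum_Ints[rotated]) (auto simp: lift_monomial_def)
  define cell where "cell x = {z. \<forall>i<length fs. attaining (fs ! i) z = attaining (fs ! i) x}" for x
  \<comment> \<open>A nonempty cell is the cell of any of its points, so the faces can be indexed by
    points instead of families \<sigma>.\<close>
  have faces: "prevariety_faces fs \<subseteq> range (\<lambda>x. closure (cell x))"
  proof
    fix F assume "F \<in> prevariety_faces fs"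
    then obtain \<sigma> where F: "F = closure {x. \<forall>i<length fs. attaining (fs ! i) x = \<sigma> i}"
      and ne: "{x. \<forall>i<length fs. attaining (fs ! i) x = \<sigma> i} \<noteq> {}"
      by (auto simp: prevariety_faces_def)
    then obtain x where "\<forall>i<length fs. attaining (fs ! i) x = \<sigma> i" by blast
    then have "{x. \<forall>i<length fs. attaining (fs ! i) x = \<sigma> i} = cell x" by (auto simp: cell_def)
    then show "F \<in> range (\<lambda>x. closure (cell x))" using F by auto
  qed
  \<comment> \<open>The monomials attaining the minimum of the product determine those of each
    factor, and lifting is injective.\<close>
  have cell_eq: "cell x = cell y" if eq: "lowest G x = lowest G y" for x y
  proof -
    have "attaining (fs ! i) x = attaining (fs ! i) y" if i: "i < length fs" for i
    proof -
      have "lift_monomial ` (fs ! i) \<in> set ?As" using i by simp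
      then have "lowest (lift_monomial ` (fs ! i)) x = lowest (lift_monomial ` (fs ! i)) y"
        using eq lowest_minkowski_sum_subset[OF As, of x y] lowest_minkowski_sum_subset[OF As, of y x]
        by (simp add: G_def subset_antisym)
      then have "lift_monomial ` attaining (fs ! i) x = lift_monomial ` attaining (fs ! i) y"
        by (simp only: lift_attaining)
      then show ?thesis by (simp add: inj_image_eq_iff[OF inj_lift_monomial])
    qed
    then show ?thesis by (simp add: cell_def)
  qed
  have r: "aff_dim (convex hull (fst ` G)) = int r" and vol: "0 < vol_r r (convex hull (fst ` G))"
    using assms(2,3) by (simp_all add: P)
  note bound = card_lowest_le_volume[OF G int r vol]
  have "closure (cell x) = closure (cell y)" if "lowest G x = lowest G y" for x y
    using cell_eq[OF that] by simp
  note fac = card_image_le_card_image_if_factors[OF bound(1) this]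
  have "card (prevariety_faces fs) \<le> card (range (\<lambda>x. closure (cell x)))"
    by (rule card_mono[OF fac(1) faces])
  also have "\<dots> \<le> card (range (lowest G))" by (rule fac(2))
  finally show ?thesis using bound(2) by (simp add: P)
qed

end
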